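(* Let $F$ be a non-Archimedean local field of characteristic $0$, let $G=\mathrm{Sp}(4,F)$, and let $(\pi,W)$ be an irreducible smooth self-dual complex representation of $G$ (that is, $\pi\simeq\pi^{\vee}$) with non-trivial vectors fixed under an Iwahori subgroup $I$ of $G$, i.e. $W^{I}\neq 0$. Then $\varepsilon(\pi)=1$; that is, the non-degenerate $G$-invariant bilinear form on $W$ is symmetric.
   Context: For a smooth representation $(\pi,W)$ of $G$, $(\pi^{\vee},W^{\vee})$ denotes its smooth dual (contragredient). If $\pi$ is irreducible, smooth and self-dual ($\pi\simeq\pi^{\vee}$), there is a non-degenerate bilinear form $(\,,\,)$ on $W$ with $(\pi(g)w_1,\pi(g)w_2)=(w_1,w_2)$ for all $g\in G$, $w_1,w_2\in W$. By Schur's lemma it is unique up to a nonzero scalar, and it is therefore either symmetric or skew-symmetric. The sign $\varepsilon(\pi)$ is defined to be $1$ if the form is symmetric and $-1$ if it is skew-symmetric. *)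

theory Defs
  imports "HOL-Analysis.Analysis"
begin

section \<open>Non-Archimedean local fields of characteristic zero\<close>

text \<open>
  The field carries a multiplicative ultrametric absolute value, written \<open>absval\<close>, inducing its
  metric and topology, for which it is complete.  The value group is discrete and non-trivial
  (\<open>w\<close> below is a uniformizer), and the residue field, i.e. the set of residue classes of the
  valuation ring \<open>{x. absval x \<le> 1}\<close> modulo its maximal ideal \<open>{x. absval x < 1}\<close>, is finite.
  No normalization of the absolute value is imposed.
\<close>

class nonarch_local_field_char_0 = field_char_0 + complete_space +
  fixes absval :: "'a \<Rightarrow> real"
  assumes dist_absval: "dist x y = absval (x - y)"
    and absval_mult: "absval (x * y) = absval x * absval y"
    and absval_add: "absval (x + y) \<le> max (absval x) (absval y)"
    and ex_uniformizer: "\<exists>w. 0 < absval w \<and> absval w < 1 \<and> (\<forall>x. absval x < 1 \<longrightarrow> absval x \<le> absval w)"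
    and finite_residue_field:
      "finite ({x. absval x \<le> 1} // {(x, y). absval x \<le> 1 \<and> absval y \<le> 1 \<and> absval (x - y) < 1})"


section \<open>The group Sp(4,F) and its Iwahori subgroups\<close>

definition J4 :: "'f::comm_ring_1^4^4" where
  "J4 = vector [vector [ 0,  0, 0, 1],
                vector [ 0,  0, 1, 0],
                vector [ 0, -1, 0, 0],
                vector [-1,  0, 0, 0]]"

definition Sp4 :: "('f::comm_ring_1^4^4) set" where
  "Sp4 = {g. transpose g ** J4 ** g = J4}"

text \<open>
  For the form \<open>J4\<close> the upper triangular matrices in \<open>Sp4\<close> form a Borel subgroup.  The standard
  Iwahori subgroup consists of the integral symplectic matrices whose reduction modulo the maximal
  ideal lies in it.  The entries below the diagonal are listed explicitly because the numeral
  \<open>4\<close> of the index type \<open>4\<close> equals \<open>0\<close>, so the order on that type is not the order of the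
  rows \<open>1, 2, 3, 4\<close>.
\<close>

definition standard_iwahori :: "('f::nonarch_local_field_char_0^4^4) set" where
  "standard_iwahori = {g \<in> Sp4. (\<forall>i j. absval (g $ i $ j) \<le> 1) \<and>
     absval (g $ 2 $ 1) < 1 \<and>
     absval (g $ 3 $ 1) < 1 \<and> absval (g $ 3 $ 2) < 1 \<and>
     absval (g $ 4 $ 1) < 1 \<and> absval (g $ 4 $ 2) < 1 \<and> absval (g $ 4 $ 3) < 1}"

text \<open>The Iwahori subgroups form a single conjugacy class in Sp(4,F).\<close>

definition iwahori_subgroup :: "('f::nonarch_local_field_char_0^4^4) set \<Rightarrow> bool" where
  "iwahori_subgroup I \<longleftrightarrow>
     (\<exists>g\<in>Sp4. I = (\<lambda>h. g ** h ** matrix_inv g) ` standard_iwahori)"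


section \<open>Representations of Sp(4,F)\<close>

text \<open>
  The representation space is a whole type with scalar multiplication \<open>smul\<close>.  The operators
  \<open>\<pi> g\<close> are constrained, and used, only for \<open>g \<in> Sp4\<close>.
\<close>

definition Sp4_representation ::
  "(complex \<Rightarrow> 'w::ab_group_add \<Rightarrow> 'w) \<Rightarrow> ('f::nonarch_local_field_char_0^4^4 \<Rightarrow> 'w \<Rightarrow> 'w) \<Rightarrow> bool" where
  "Sp4_representation smul \<pi> \<longleftrightarrow>
     vector_space smul \<and>
     (\<forall>g\<in>Sp4. Vector_Spaces.linear smul smul (\<pi> g)) \<and>
     (\<forall>v. \<pi> (mat 1) v = v) \<and>
     (\<forall>g\<in>Sp4. \<forall>h\<in>Sp4. \<forall>v. \<pi> (g ** h) v = \<pi> g (\<pi> h v))"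

text \<open>A vector is smooth if its stabilizer is open, \<open>Sp4\<close> having the subspace topology from
  the space of matrices.  The space \<open>'v\<close> is arbitrary so as to cover functionals as well.\<close>

definition smooth_vector ::
  "('f::nonarch_local_field_char_0^4^4 \<Rightarrow> 'v \<Rightarrow> 'v) \<Rightarrow> 'v \<Rightarrow> bool" where
  "smooth_vector \<rho> v \<longleftrightarrow> openin (top_of_set Sp4) {g \<in> Sp4. \<rho> g v = v}"

definition smooth_rep :: "('f::nonarch_local_field_char_0^4^4 \<Rightarrow> 'w \<Rightarrow> 'w) \<Rightarrow> bool" where
  "smooth_rep \<pi> \<longleftrightarrow> (\<forall>v. smooth_vector \<pi> v)"

definition irreducible_rep ::
  "(complex \<Rightarrow> 'w::ab_group_add \<Rightarrow> 'w) \<Rightarrow> ('f::nonarch_local_field_char_0^4^4 \<Rightarrow> 'w \<Rightarrow> 'w) \<Rightarrow> bool" where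
  "irreducible_rep smul \<pi> \<longleftrightarrow>
     (UNIV :: 'w set) \<noteq> {0} \<and>
     (\<forall>U. module.subspace smul U \<and> (\<forall>g\<in>Sp4. \<pi> g ` U \<subseteq> U) \<longrightarrow> U = {0} \<or> U = UNIV)"

definition fixed_vectors :: "('f^4^4 \<Rightarrow> 'w \<Rightarrow> 'w) \<Rightarrow> ('f^4^4) set \<Rightarrow> 'w set" where
  "fixed_vectors \<pi> I = {v. \<forall>h\<in>I. \<pi> h v = v}"


section \<open>The smooth dual\<close>

definition dual_action ::
  "('f::nonarch_local_field_char_0^4^4 \<Rightarrow> 'w \<Rightarrow> 'w) \<Rightarrow> 'f^4^4 \<Rightarrow> ('w \<Rightarrow> complex) \<Rightarrow> ('w \<Rightarrow> complex)" where
  "dual_action \<pi> g l = (\<lambda>v. l (\<pi> (matrix_inv g) v))"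

definition smooth_dual ::
  "(complex \<Rightarrow> 'w::ab_group_add \<Rightarrow> 'w) \<Rightarrow> ('f::nonarch_local_field_char_0^4^4 \<Rightarrow> 'w \<Rightarrow> 'w)
    \<Rightarrow> ('w \<Rightarrow> complex) set" where
  "smooth_dual smul \<pi> =
     {l. Vector_Spaces.linear smul (*) l \<and> smooth_vector (dual_action \<pi>) l}"

definition self_dual ::
  "(complex \<Rightarrow> 'w::ab_group_add \<Rightarrow> 'w) \<Rightarrow> ('f::nonarch_local_field_char_0^4^4 \<Rightarrow> 'w \<Rightarrow> 'w) \<Rightarrow> bool" where
  "self_dual smul \<pi> \<longleftrightarrow>
     (\<exists>\<phi>. bij_betw \<phi> UNIV (smooth_dual smul \<pi>) \<and>
          (\<forall>v w. \<phi> (v + w) = (\<lambda>x. \<phi> v x + \<phi> w x)) \<and>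
          (\<forall>c v. \<phi> (smul c v) = (\<lambda>x. c * \<phi> v x)) \<and>
          (\<forall>g\<in>Sp4. \<forall>v. \<phi> (\<pi> g v) = dual_action \<pi> g (\<phi> v)))"


section \<open>Invariant forms and the sign\<close>

definition invariant_form ::
  "(complex \<Rightarrow> 'w::ab_group_add \<Rightarrow> 'w) \<Rightarrow> ('f::nonarch_local_field_char_0^4^4 \<Rightarrow> 'w \<Rightarrow> 'w)
    \<Rightarrow> ('w \<Rightarrow> 'w \<Rightarrow> complex) \<Rightarrow> bool" where
  "invariant_form smul \<pi> B \<longleftrightarrow>
     (\<forall>v. Vector_Spaces.linear smul (*) (\<lambda>w. B v w)) \<and>
     (\<forall>w. Vector_Spaces.linear smul (*) (\<lambda>v. B v w)) \<and>
     (\<forall>g\<in>Sp4. \<forall>v w. B (\<pi> g v) (\<pi> g w) = B v w)"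

definition nondegenerate_form :: "('w::zero \<Rightarrow> 'w \<Rightarrow> complex) \<Rightarrow> bool" where
  "nondegenerate_form B \<longleftrightarrow>
     (\<forall>v. (\<forall>w. B v w = 0) \<longrightarrow> v = 0) \<and> (\<forall>w. (\<forall>v. B v w = 0) \<longrightarrow> w = 0)"

definition symmetric_form :: "('w \<Rightarrow> 'w \<Rightarrow> complex) \<Rightarrow> bool" where
  "symmetric_form B \<longleftrightarrow> (\<forall>v w. B v w = B w v)"

definition skew_symmetric_form :: "('w \<Rightarrow> 'w \<Rightarrow> complex) \<Rightarrow> bool" where
  "skew_symmetric_form B \<longleftrightarrow> (\<forall>v w. B v w = - B w v)"

text \<open>For irreducible smooth self-dual \<open>\<pi>\<close> the form exists and is unique up to a nonzero scalar,
  so that the description below is proper; otherwise the value is unspecified.\<close>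

definition rep_sign ::
  "(complex \<Rightarrow> 'w::ab_group_add \<Rightarrow> 'w) \<Rightarrow> ('f::nonarch_local_field_char_0^4^4 \<Rightarrow> 'w \<Rightarrow> 'w) \<Rightarrow> int" where
  "rep_sign smul \<pi> =
     (THE e. \<exists>B. invariant_form smul \<pi> B \<and> nondegenerate_form B \<and>
                 (e = 1 \<and> symmetric_form B \<or> e = -1 \<and> skew_symmetric_form B))"

end

(* Every invariant form is symmetric as soon as no nondegenerate invariant form B is skew, because the
   radical of the skew part of an invariant form is an invariant subspace.  Suppose B is skew.  On the
   space W of Iwahori-fixed vectors the Hecke operators T0, T1, T2 of the simple affine reflections are
   self-adjoint for B.  By irreducibility and the Bruhat decomposition it suffices to find a nonzero v
   in W whose matrix coefficients B (pi w v) v vanish for all monomial w.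

   If v is a common eigenvector of T1, T2 or of T1, T0 (a character of the finite Hecke algebra at a
   hyperspecial vertex), they vanish because every double coset of the finite Weyl group in the affine
   one contains an involution w, for which B (pi w v) v = B v (pi w v) = - B (pi w v) v.  If there is
   no such v, both finite Hecke algebras act through their reflection representations, which yields
   Temperley-Lieb type relations: the q-eigenspace of T1 is then acted upon only by the powers of one
   self-adjoint operator X, and a skew form satisfies B (X^k v) v = 0. *)

theory Submission
  imports Defs
begin

subsection \<open>The absolute value\<close>

text \<open>The vanishing of \<open>B (\<pi> w v) v\<close> is propagated along words in the simple
  reflections: by invariance, multiplying \<open>w\<close> by \<open>s\<close> on the left amounts
  to putting the Hecke operator of \<open>s\<close> into the other slot, up to the factor
  \<open>q\<close>, either from \<open>w\<close> to \<open>s ** w\<close> or back. The involutions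
  come from the longest element of the finite Weyl group of type C2: it acts as -1 on cocharacters,
  so its product with any diagonal matrix squares to the same central sign. A Hecke algebra of the
  dihedral group of order 8 has four characters and one two-dimensional irreducible module; once no
  character occurs, (T1+1)(T2+1)(T1+1) = 2q(T1+1), where 2 = 4 cos^2(pi/4), and likewise with T0. No
  such relation ties T0 to T2: they merely commute, so the compression X of T0 T2 to the
  q-eigenspace of T1 is the one operator that stays free, and commutation makes it self-adjoint. The
  two hyperspecial vertices are not conjugate in Sp(4,F); the similitude automorphism
  \<open>theta\<close> carries statements from one to the other.\<close>

lemma absval_zero [simp]: "absval 0 = 0"
  using dist_absval[of 0 0] by simp

lemma absval_nonneg [simp]: "0 \<le> absval x"
  using dist_absval[of x 0] zero_le_dist[of x 0] by simp

lemma absval_eq_zero_iff [simp]: "absval x = 0 \<longleftrightarrow> x = 0"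
  using dist_absval[of x 0] dist_eq_0_iff[of x 0] by simp

lemma absval_one [simp]: "absval 1 = 1"
  using absval_mult[of 1 1] absval_eq_zero_iff[of 1] by simp

lemma absval_uminus [simp]: "absval (- x) = absval x"
  using dist_absval[of 0 x] dist_absval[of x 0] dist_commute[of x 0] by simp

lemma absval_minus_commute: "absval (x - y) = absval (y - x)"
  using absval_uminus[of "x - y"] by simp

lemma absval_inverse: "absval (inverse x) = inverse (absval x)"
proof (cases "x = 0")
  case False
  then have "absval (inverse x) * absval x = 1"
    using absval_mult[of "inverse x" x] by simp
  then show ?thesis
    using False by (simp add: field_simps)
qed simp

lemma absval_divide: "absval (x / y) = absval x / absval y"
  by (simp add: absval_mult absval_inverse divide_inverse)

lemma absval_add_le: "absval x \<le> c \<Longrightarrow> absval y \<le> c \<Longrightarrow> absval (x + y) \<le> c"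
  using absval_add[of x y] by simp

lemma absval_add_less: "absval x < c \<Longrightarrow> absval y < c \<Longrightarrow> absval (x + y) < c"
  using absval_add[of x y] by simp

lemma absval_diff_le: "absval x \<le> c \<Longrightarrow> absval y \<le> c \<Longrightarrow> absval (x - y) \<le> c"
  using absval_add_le[of x c "- y"] by simp

lemma absval_diff_less: "absval x < c \<Longrightarrow> absval y < c \<Longrightarrow> absval (x - y) < c"
  using absval_add_less[of x c "- y"] by simp

lemma absval_mult_le: "absval x \<le> 1 \<Longrightarrow> absval y \<le> 1 \<Longrightarrow> absval (x * y) \<le> 1"
  by (simp add: absval_mult mult_le_one)

lemma absval_mult_less_left: "absval x < 1 \<Longrightarrow> absval y \<le> 1 \<Longrightarrow> absval (x * y) < 1"
  by (metis absval_mult absval_nonneg mult_left_le order.strict_trans1)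

lemma absval_mult_less_right: "absval x \<le> 1 \<Longrightarrow> absval y < 1 \<Longrightarrow> absval (x * y) < 1"
  using absval_mult_less_left[of y x] by (simp add: mult.commute)

lemma absval_eq_one_of_near_one:
  fixes x y :: "'a::nonarch_local_field_char_0"
  assumes "absval x \<le> 1" "absval y \<le> 1" "absval (x * y - 1) < 1"
  shows "absval x = 1"
proof (rule ccontr)
  assume "absval x \<noteq> 1"
  then have "absval (x * y) < 1"
    using assms absval_mult_less_left[of x y] by simp
  then have "absval (x * y - (x * y - 1)) < 1"
    using assms(3) by (rule absval_diff_less)
  then show False by simp
qed

section \<open>Uniformizers and induction over the value group\<close>

definition uniformizer :: "'a::nonarch_local_field_char_0" where
  "uniformizer = (SOME w. 0 < absval w \<and> absval w < 1 \<and> (\<forall>x::'a. absval x < 1 \<longrightarrow> absval x \<le> absval w))"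

lemma uniformizer:
  fixes x :: "'a::nonarch_local_field_char_0"
  shows "0 < absval (uniformizer :: 'a)" and "absval (uniformizer :: 'a) < 1"
    and "absval x < 1 \<Longrightarrow> absval x \<le> absval (uniformizer :: 'a)"
proof -
  have *: "0 < absval (uniformizer :: 'a) \<and> absval (uniformizer :: 'a) < 1 \<and>
      (\<forall>x::'a. absval x < 1 \<longrightarrow> absval x \<le> absval (uniformizer :: 'a))"
    unfolding uniformizer_def by (rule someI_ex[OF ex_uniformizer])
  from * show "0 < absval (uniformizer :: 'a)" by blast
  from * show "absval (uniformizer :: 'a) < 1" by blast
  from * show "absval x \<le> absval (uniformizer :: 'a)" if "absval x < 1"
    using that by blast
qed

lemma uniformizer_nonzero [simp]: "(uniformizer :: 'a::nonarch_local_field_char_0) \<noteq> 0"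
  using uniformizer(1)[where 'a='a] by auto

lemma absval_div_uniformizer:
  fixes x :: "'a::nonarch_local_field_char_0"
  assumes "absval x < 1"
  shows "absval (x / uniformizer) \<le> 1"
  using uniformizer(1)[where 'a='a] uniformizer(3)[of x] assms by (simp add: absval_divide)

text \<open>A nonzero \<open>a\<close> is a unit times an integral power of the uniformizer, by
  discreteness of the value group. The step is an equivalence so that both positive and negative
  powers are reached.\<close>

lemma uniformizer_induct:
  fixes a :: "'a::nonarch_local_field_char_0"
  assumes unit: "\<And>a. absval a = 1 \<Longrightarrow> Q a"
    and step: "\<And>a. a \<noteq> 0 \<Longrightarrow> Q a \<longleftrightarrow> Q (uniformizer * a)"
    and "a \<noteq> 0"
  shows "Q a"
proof -
  let ?w = "uniformizer :: 'a"
  \<comment> \<open>The exponent \<open>n\<close> bounds how often \<open>a\<close> can be divided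
    by the uniformizer; for \<open>n = 0\<close> the two bounds contradict each other.\<close>
  have small: "Q a" if "absval ?w ^ n < absval a" "absval a \<le> 1" for n a
    using that
  proof (induction n arbitrary: a)
    case (Suc n)
    show ?case
    proof (cases "absval a = 1")
      case False
      define b where "b = a / ?w"
      have "absval a < 1"
        using False Suc.prems by simp
      then have "absval b \<le> 1"
        unfolding b_def by (rule absval_div_uniformizer)
      moreover have "absval ?w ^ n < absval b"
        using Suc.prems uniformizer(1)[where 'a='a] by (simp add: b_def absval_divide pos_less_divide_eq mult.commute)
      ultimately have "Q b"
        using Suc.IH by blast
      moreover have "b \<noteq> 0"
        using \<open>absval ?w ^ n < absval b\<close> uniformizer(1)[where 'a='a] by (auto simp: not_less)
      ultimately show ?thesis
        using step[of b] by (simp add: b_def)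
    qed (use unit in blast)
  qed simp
  have small': "Q a" if "a \<noteq> 0" "absval a \<le> 1" for a
  proof -
    have "0 < absval a"
      using that absval_eq_zero_iff[of a] absval_nonneg[of a] by linarith
    from real_arch_pow_inv[OF this uniformizer(2)] show ?thesis
      using small that by blast
  qed
  have large: "Q a" if "absval ?w ^ n * absval a \<le> 1" "a \<noteq> 0" for n a
    using that
  proof (induction n arbitrary: a)
    case 0
    then show ?case using small' by simp
  next
    case (Suc n)
    have "Q (?w * a)"
      by (rule Suc.IH) (use Suc.prems in \<open>auto simp: absval_mult mult_ac\<close>)
    then show ?case using step Suc.prems by blast
  qed
  have "0 < absval a"
    using \<open>a \<noteq> 0\<close> absval_eq_zero_iff[of a] absval_nonneg[of a] by linarith
  then obtain n where "absval ?w ^ n < 1 / absval a"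
    using real_arch_pow_inv[of "1 / absval a" "absval ?w"] uniformizer(1,2)[where 'a='a] by auto
  then show ?thesis
    using \<open>0 < absval a\<close> by (intro large[of n]) (auto simp: field_simps)
qed

section \<open>Representatives of the residue field and sums over them\<close>

lemma ex_residue_reps:
  "\<exists>R::'a::nonarch_local_field_char_0 set. finite R \<and> (\<forall>r\<in>R. absval r \<le> 1) \<and>
       (\<forall>t. absval t \<le> 1 \<longrightarrow> (\<exists>!r. r \<in> R \<and> absval (t - r) < 1))"
proof -
  let ?O = "{x::'a. absval x \<le> 1}"
  let ?E = "{(x::'a, y). absval x \<le> 1 \<and> absval y \<le> 1 \<and> absval (x - y) < 1}"
  have trans: "absval (x - z) < 1" if "absval (x - y) < 1" "absval (y - z) < 1" for x y z
    using absval_add_less[OF that] by simp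
  define rep :: "'a \<Rightarrow> 'a" where "rep t = (SOME r. r \<in> ?E `` {t})" for t
  have rep: "rep t \<in> ?E `` {t}" if "t \<in> ?O" for t
    unfolding rep_def by (rule someI[of _ t]) (use that in simp)
  have rep_eq: "rep t = rep u" if "t \<in> ?O" "u \<in> ?O" "absval (t - u) < 1" for t u
  proof -
    have "?E `` {t} = ?E `` {u}"
      using that trans[of t u] trans[of u t] absval_minus_commute[of t u] by auto
    then show ?thesis unfolding rep_def by simp
  qed
  have "rep ` ?O = (\<lambda>X. SOME r. r \<in> X) ` (?O // ?E)"
    unfolding rep_def quotient_def image_UN image_image by blast
  then have "finite (rep ` ?O)"
    using finite_residue_field[where 'a='a] by simp
  moreover have "\<forall>r\<in>rep ` ?O. absval r \<le> 1"
    using rep by auto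
  moreover have "\<exists>!r. r \<in> rep ` ?O \<and> absval (t - r) < 1" if "absval t \<le> 1" for t
  proof (rule ex1I[of _ "rep t"])
    show "rep t \<in> rep ` ?O \<and> absval (t - rep t) < 1"
      using that rep[of t] by auto
    fix r assume r: "r \<in> rep ` ?O \<and> absval (t - r) < 1"
    then obtain u where u: "absval u \<le> 1" "r = rep u" by auto
    then have "absval (u - r) < 1"
      using rep[of u] by auto
    then have "absval (t - u) < 1"
      using trans[of t r u] r absval_minus_commute[of u r] by simp
    then show "r = rep t"
      using rep_eq[of t u] that u by simp
  qed
  ultimately show ?thesis by blast
qed

definition residue_reps :: "'a::nonarch_local_field_char_0 set" where
  "residue_reps = (SOME R. finite R \<and> (\<forall>r\<in>R. absval r \<le> 1) \<and>
       (\<forall>t. absval t \<le> 1 \<longrightarrow> (\<exists>!r. r \<in> R \<and> absval (t - r) < 1)))"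

lemma finite_residue_reps [simp]: "finite residue_reps"
  and absval_residue_rep: "r \<in> residue_reps \<Longrightarrow> absval r \<le> 1"
  and ex1_residue_rep: "absval t \<le> 1 \<Longrightarrow> \<exists>!r. r \<in> residue_reps \<and> absval (t - r) < 1"
  using someI_ex[OF ex_residue_reps] unfolding residue_reps_def[symmetric] by auto

lemma card_residue_reps_pos: "0 < card (residue_reps :: 'a::nonarch_local_field_char_0 set)"
  using ex1_residue_rep[of 0] by (auto simp: card_gt_0_iff)

text \<open>An injection of the finite residue field into itself is a bijection. The map
  \<open>f\<close> need not respect congruence, so it may come from a mere choice of witnesses, as
  in \<open>T_W\<close>.\<close>

lemma sum_residue_reps_reindex:
  fixes F :: "'a::nonarch_local_field_char_0 \<Rightarrow> 'b::comm_monoid_add" and f :: "'a \<Rightarrow> 'a"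
  assumes F: "\<And>t u. absval t \<le> 1 \<Longrightarrow> absval u \<le> 1 \<Longrightarrow> absval (t - u) < 1 \<Longrightarrow> F t = F u"
    and f: "\<And>t. absval t \<le> 1 \<Longrightarrow> absval (f t) \<le> 1"
    and inj: "\<And>t u. absval t \<le> 1 \<Longrightarrow> absval u \<le> 1 \<Longrightarrow> absval (f t - f u) < 1 \<Longrightarrow> absval (t - u) < 1"
  shows "(\<Sum>t\<in>residue_reps. F (f t)) = (\<Sum>t\<in>residue_reps. F t)"
proof -
  define rep :: "'a \<Rightarrow> 'a" where "rep t = (THE r. r \<in> residue_reps \<and> absval (t - r) < 1)" for t
  have rep: "rep t \<in> residue_reps" "absval (t - rep t) < 1" if "absval t \<le> 1" for t
    using theI'[OF ex1_residue_rep[OF that]] unfolding rep_def by auto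
  have inj_on: "inj_on (\<lambda>t. rep (f t)) residue_reps"
  proof (rule inj_onI)
    fix t u assume tu: "t \<in> residue_reps" "u \<in> residue_reps" "rep (f t) = rep (f u)"
    then have "absval t \<le> 1" "absval u \<le> 1" using absval_residue_rep by auto
    moreover from this have "absval ((f t - rep (f t)) - (f u - rep (f u))) < 1"
      by (intro absval_diff_less rep f)
    ultimately have "absval (t - u) < 1"
      using inj[of t u] tu by simp
    then show "t = u"
      using ex1_residue_rep[OF \<open>absval t \<le> 1\<close>] tu by (metis absval_zero diff_self zero_less_one)
  qed
  have "(\<lambda>t. rep (f t)) ` residue_reps \<subseteq> residue_reps"
    using rep f absval_residue_rep by auto
  then have "bij_betw (\<lambda>t. rep (f t)) residue_reps residue_reps"
    unfolding bij_betw_def using inj_on endo_inj_surj[OF finite_residue_reps, of "\<lambda>t. rep (f t)"] by simp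
  then have "(\<Sum>t\<in>residue_reps. F (rep (f t))) = (\<Sum>t\<in>residue_reps. F t)"
    by (rule sum.reindex_bij_betw[where g = F])
  moreover have "F (rep (f t)) = F (f t)" if "t \<in> residue_reps" for t
  proof -
    have "absval (f t) \<le> 1" using that f absval_residue_rep by blast
    then show ?thesis
      using F[of "f t" "rep (f t)"] rep[of "f t"] absval_residue_rep[of "rep (f t)"] by simp
  qed
  ultimately show ?thesis by simp
qed

lemma sum_residue_reps_shift:
  fixes F :: "'a::nonarch_local_field_char_0 \<Rightarrow> 'b::comm_monoid_add"
  assumes "\<And>t u. absval t \<le> 1 \<Longrightarrow> absval u \<le> 1 \<Longrightarrow> absval (t - u) < 1 \<Longrightarrow> F t = F u"
    and "absval c \<le> 1"
  shows "(\<Sum>t\<in>residue_reps. F (t + c)) = (\<Sum>t\<in>residue_reps. F t)"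
proof (rule sum_residue_reps_reindex[where F = F, OF assms(1)])
  show "absval (t + c) \<le> 1" if "absval t \<le> 1" for t
    using that assms(2) by (rule absval_add_le)
  show "absval (t - u) < 1" if "absval (t + c - (u + c)) < 1" for t u
    using that by simp
qed

lemma sum_residue_reps_reflect:
  fixes F :: "'a::nonarch_local_field_char_0 \<Rightarrow> 'b::comm_monoid_add"
  assumes "\<And>t u. absval t \<le> 1 \<Longrightarrow> absval u \<le> 1 \<Longrightarrow> absval (t - u) < 1 \<Longrightarrow> F t = F u"
    and "absval c \<le> 1"
  shows "(\<Sum>t\<in>residue_reps. F (c - t)) = (\<Sum>t\<in>residue_reps. F t)"
proof (rule sum_residue_reps_reindex[where F = F, OF assms(1)])
  show "absval (c - t) \<le> 1" if "absval t \<le> 1" for t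
    using assms(2) that by (rule absval_diff_le)
  show "absval (t - u) < 1" if "absval (c - t - (c - u)) < 1" for t u
    using that absval_minus_commute[of t u] by (simp add: algebra_simps)
qed

subsection \<open>Four by four symplectic matrices\<close>

lemma distinct_indices4 [simp]:
  "(1::4) \<noteq> 2" "(1::4) \<noteq> 3" "(1::4) \<noteq> 4" "(2::4) \<noteq> 3" "(2::4) \<noteq> 4" "(3::4) \<noteq> 4"
  "(2::4) \<noteq> 1" "(3::4) \<noteq> 1" "(4::4) \<noteq> 1" "(3::4) \<noteq> 2" "(4::4) \<noteq> 2" "(4::4) \<noteq> 3"
  by simp_all

text \<open>An explicit constructor turns identities between matrix products into sixteen polynomial
  identities for the simplifier.\<close>

definition mat4 :: "'a \<Rightarrow> 'a \<Rightarrow> 'a \<Rightarrow> 'a \<Rightarrow> 'a \<Rightarrow> 'a \<Rightarrow> 'a \<Rightarrow> 'a \<Rightarrow>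
    'a \<Rightarrow> 'a \<Rightarrow> 'a \<Rightarrow> 'a \<Rightarrow> 'a \<Rightarrow> 'a \<Rightarrow> 'a \<Rightarrow> 'a \<Rightarrow> 'a^4^4" where
  "mat4 a b c d e f g h i j k l m n p q =
    (\<chi> r s. if r = 1 then (if s = 1 then a else if s = 2 then b else if s = 3 then c else d)
       else if r = 2 then (if s = 1 then e else if s = 2 then f else if s = 3 then g else h)
       else if r = 3 then (if s = 1 then i else if s = 2 then j else if s = 3 then k else l)
       else (if s = 1 then m else if s = 2 then n else if s = 3 then p else q))"

lemma mat4_nth [simp]:
  "mat4 a b c d e f g h i j k l m n p q $ 1 $ 1 = a"
  "mat4 a b c d e f g h i j k l m n p q $ 1 $ 2 = b"
  "mat4 a b c d e f g h i j k l m n p q $ 1 $ 3 = c"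
  "mat4 a b c d e f g h i j k l m n p q $ 1 $ 4 = d"
  "mat4 a b c d e f g h i j k l m n p q $ 2 $ 1 = e"
  "mat4 a b c d e f g h i j k l m n p q $ 2 $ 2 = f"
  "mat4 a b c d e f g h i j k l m n p q $ 2 $ 3 = g"
  "mat4 a b c d e f g h i j k l m n p q $ 2 $ 4 = h"
  "mat4 a b c d e f g h i j k l m n p q $ 3 $ 1 = i"
  "mat4 a b c d e f g h i j k l m n p q $ 3 $ 2 = j"
  "mat4 a b c d e f g h i j k l m n p q $ 3 $ 3 = k"
  "mat4 a b c d e f g h i j k l m n p q $ 3 $ 4 = l"
  "mat4 a b c d e f g h i j k l m n p q $ 4 $ 1 = m"
  "mat4 a b c d e f g h i j k l m n p q $ 4 $ 2 = n"
  "mat4 a b c d e f g h i j k l m n p q $ 4 $ 3 = p"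
  "mat4 a b c d e f g h i j k l m n p q $ 4 $ 4 = q"
  unfolding mat4_def by (simp_all del: numeral_eq_iff)

lemma mat4_eta:
  "A = mat4 (A$1$1) (A$1$2) (A$1$3) (A$1$4) (A$2$1) (A$2$2) (A$2$3) (A$2$4)
            (A$3$1) (A$3$2) (A$3$3) (A$3$4) (A$4$1) (A$4$2) (A$4$3) (A$4$4)"
  unfolding vec_eq_iff forall_4 mat4_nth by blast

lemma mat4_eq_iff [simp]:
  "mat4 a b c d e f g h i j k l m n p q = mat4 a' b' c' d' e' f' g' h' i' j' k' l' m' n' p' q' \<longleftrightarrow>
   a = a' \<and> b = b' \<and> c = c' \<and> d = d' \<and> e = e' \<and> f = f' \<and> g = g' \<and> h = h' \<and>
   i = i' \<and> j = j' \<and> k = k' \<and> l = l' \<and> m = m' \<and> n = n' \<and> p = p' \<and> q = q'"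
  unfolding vec_eq_iff forall_4 mat4_nth by blast

lemma mat4_mult [simp]:
  fixes a :: "'a::semiring_1"
  shows "mat4 a b c d e f g h i j k l m n p q ** mat4 a' b' c' d' e' f' g' h' i' j' k' l' m' n' p' q' =
   mat4 (a*a' + b*e' + c*i' + d*m') (a*b' + b*f' + c*j' + d*n') (a*c' + b*g' + c*k' + d*p') (a*d' + b*h' + c*l' + d*q')
        (e*a' + f*e' + g*i' + h*m') (e*b' + f*f' + g*j' + h*n') (e*c' + f*g' + g*k' + h*p') (e*d' + f*h' + g*l' + h*q')
        (i*a' + j*e' + k*i' + l*m') (i*b' + j*f' + k*j' + l*n') (i*c' + j*g' + k*k' + l*p') (i*d' + j*h' + k*l' + l*q')
        (m*a' + n*e' + p*i' + q*m') (m*b' + n*f' + p*j' + q*n') (m*c' + n*g' + p*k' + q*p') (m*d' + n*h' + p*l' + q*q')"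
  unfolding vec_eq_iff forall_4 mat4_nth matrix_matrix_mult_def
  by (simp add: sum_4)

lemma transpose_mat4 [simp]:
  "transpose (mat4 a b c d e f g h i j k l m n p q) = mat4 a e i m b f j n c g k p d h l q"
  unfolding vec_eq_iff forall_4 mat4_nth by (simp add: transpose_def)

lemma mat_one_mat4: "mat 1 = mat4 1 0 0 0 0 1 0 0 0 0 1 0 0 0 0 1"
  unfolding vec_eq_iff forall_4 mat4_nth by (simp add: mat_def)

lemma J4_mat4: "J4 = mat4 0 0 0 1 0 0 1 0 0 (- 1) 0 0 (- 1) 0 0 0"
  unfolding vec_eq_iff forall_4 mat4_nth J4_def by (simp add: vector_def)

text \<open>The adjoint for the form: the inverse of \<open>J4\<close>, times
  \<open>transpose g\<close>, times \<open>J4\<close>. On \<open>Sp4\<close> it is the inverse;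
  being linear in the entries, it is an anti-involution on all matrices and computes without
  division.\<close>

definition spinv :: "'f::comm_ring_1^4^4 \<Rightarrow> 'f^4^4" where
  "spinv g = mat4 (g$4$4) (g$3$4) (- g$2$4) (- g$1$4)
                  (g$4$3) (g$3$3) (- g$2$3) (- g$1$3)
                  (- g$4$2) (- g$3$2) (g$2$2) (g$1$2)
                  (- g$4$1) (- g$3$1) (g$2$1) (g$1$1)"

lemma spinv_mat4 [simp]:
  "spinv (mat4 a b c d e f g h i j k l m n p q) =
     mat4 q l (- h) (- d) p k (- g) (- c) (- n) (- j) f b (- m) (- i) e a"
  by (simp add: spinv_def)

lemma spinv_spinv [simp]: "spinv (spinv g) = g"
  by (subst (2) mat4_eta) (simp add: spinv_def)

lemma spinv_mult: "spinv (g ** h) = spinv h ** spinv g"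
  by (subst (1 2) mat4_eta[of g], subst (1 2) mat4_eta[of h]) (simp add: algebra_simps)

lemma Sp4_iff: "g \<in> Sp4 \<longleftrightarrow> spinv g ** g = mat 1"
proof -
  define J' :: "'a^4^4" where "J' = mat4 0 0 0 (- 1) 0 0 (- 1) 0 0 1 0 0 1 0 0 0"
  have J: "J4 ** J' = mat 1" "J' ** J4 = mat 1"
    by (simp_all add: J4_mat4 J'_def mat_one_mat4)
  have s: "spinv g = J' ** transpose g ** J4"
    by (subst (1 2) mat4_eta[of g]) (simp add: J4_mat4 J'_def)
  show ?thesis
  proof
    assume "g \<in> Sp4"
    then have "transpose g ** J4 ** g = J4"
      by (simp add: Sp4_def)
    then show "spinv g ** g = mat 1"
      using J unfolding s by (metis matrix_mul_assoc)
  next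
    assume "spinv g ** g = mat 1"
    then have "J' ** (transpose g ** J4 ** g) = mat 1"
      unfolding s by (simp add: matrix_mul_assoc)
    then have "J4 ** (J' ** (transpose g ** J4 ** g)) = J4"
      by (simp add: matrix_mul_rid)
    then show "g \<in> Sp4"
      using J by (simp add: Sp4_def matrix_mul_assoc matrix_mul_lid)
  qed
qed

lemma spinv_Sp4 [simp, intro]:
  fixes g :: "'f::field^4^4"
  assumes "g \<in> Sp4" shows "spinv g \<in> Sp4"
  using assms matrix_left_right_inverse[of "spinv g" g] by (simp add: Sp4_iff)

lemma Sp4_mult [simp, intro]:
  assumes "g \<in> Sp4" "h \<in> Sp4" shows "g ** h \<in> Sp4"
proof -
  have "spinv h ** (spinv g ** g) ** h = mat 1"
    using assms by (simp add: Sp4_iff matrix_mul_rid)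
  then show ?thesis
    by (simp add: Sp4_iff spinv_mult matrix_mul_assoc)
qed

lemma Sp4_cancel [simp]:
  fixes g :: "'f::field^4^4"
  assumes "g \<in> Sp4"
  shows "spinv g ** g = mat 1" "g ** spinv g = mat 1"
    "A ** spinv g ** g = A" "A ** g ** spinv g = A"
proof -
  show *: "spinv g ** g = mat 1" "g ** spinv g = mat 1"
    using assms matrix_left_right_inverse[of "spinv g" g] by (simp_all add: Sp4_iff)
  show "A ** spinv g ** g = A" "A ** g ** spinv g = A"
    using * by (simp_all add: matrix_mul_assoc[symmetric] matrix_mul_rid)
qed

lemmas mat_simps = matrix_mul_assoc matrix_mul_lid matrix_mul_rid spinv_mult

lemma Sp4_mat_1 [simp]: "mat 1 \<in> Sp4"
  by (simp add: Sp4_iff mat_one_mat4)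

lemma spinv_mat_1 [simp]: "spinv (mat 1) = mat 1"
  by (simp add: mat_one_mat4)

lemma matrix_inv_Sp4:
  fixes g :: "'f::field^4^4"
  assumes "g \<in> Sp4" shows "matrix_inv g = spinv g"
proof -
  have "g ** matrix_inv g = mat 1 \<and> matrix_inv g ** g = mat 1"
    unfolding matrix_inv_def by (rule someI[of _ "spinv g"]) (use assms in simp)
  then have "matrix_inv g ** g ** spinv g = spinv g"
    by (simp add: matrix_mul_lid)
  then show ?thesis
    using assms by simp
qed

abbreviation iwahori :: "('f::nonarch_local_field_char_0^4^4) set" where
  "iwahori \<equiv> standard_iwahori"

lemma iwahori_mat4:
  "mat4 a b c d e f g h i j k l m n p q \<in> iwahori \<longleftrightarrow>
   mat4 a b c d e f g h i j k l m n p q \<in> Sp4 \<and>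
   absval a \<le> 1 \<and> absval b \<le> 1 \<and> absval c \<le> 1 \<and> absval d \<le> 1 \<and>
   absval e < 1 \<and> absval f \<le> 1 \<and> absval g \<le> 1 \<and> absval h \<le> 1 \<and>
   absval i < 1 \<and> absval j < 1 \<and> absval k \<le> 1 \<and> absval l \<le> 1 \<and>
   absval m < 1 \<and> absval n < 1 \<and> absval p < 1 \<and> absval q \<le> 1"
  unfolding standard_iwahori_def forall_4 by (auto simp: less_imp_le)

lemma iwahori_iff:
  "g \<in> iwahori \<longleftrightarrow> g \<in> Sp4 \<and>
   absval (g$1$1) \<le> 1 \<and> absval (g$1$2) \<le> 1 \<and> absval (g$1$3) \<le> 1 \<and> absval (g$1$4) \<le> 1 \<and>
   absval (g$2$1) < 1 \<and> absval (g$2$2) \<le> 1 \<and> absval (g$2$3) \<le> 1 \<and> absval (g$2$4) \<le> 1 \<and>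
   absval (g$3$1) < 1 \<and> absval (g$3$2) < 1 \<and> absval (g$3$3) \<le> 1 \<and> absval (g$3$4) \<le> 1 \<and>
   absval (g$4$1) < 1 \<and> absval (g$4$2) < 1 \<and> absval (g$4$3) < 1 \<and> absval (g$4$4) \<le> 1"
  unfolding standard_iwahori_def forall_4 by (auto simp: less_imp_le)

lemma iwahori_Sp4 [simp, intro]: "h \<in> iwahori \<Longrightarrow> h \<in> Sp4"
  by (simp add: iwahori_iff)

lemma iwahori_mat_1 [simp]: "mat 1 \<in> iwahori"
  using Sp4_mat_1 unfolding mat_one_mat4 iwahori_mat4 by simp

lemma iwahori_spinv [simp, intro]: "h \<in> iwahori \<Longrightarrow> spinv h \<in> iwahori"
  using spinv_Sp4[of h] by (simp add: iwahori_iff) (simp add: spinv_def)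

lemma iwahori_mult [simp, intro]:
  assumes "g \<in> iwahori" "h \<in> iwahori" shows "g ** h \<in> iwahori"
proof -
  note g = assms(1)[unfolded iwahori_iff] and h = assms(2)[unfolded iwahori_iff]
  show ?thesis
    unfolding iwahori_iff
  proof (intro conjI)
    show "g ** h \<in> Sp4"
      using assms by simp
  qed (unfold matrix_matrix_mult_def vec_lambda_beta sum_4,
      (intro absval_add_le absval_add_less;
       rule absval_mult_less_left absval_mult_less_right absval_mult_le,
       (simp only: g h less_imp_le; fail), (simp only: g h less_imp_le; fail))+)
qed

text \<open>The normalizer of the diagonal torus. Modulo unit diagonal matrices it is the affine
  Weyl group; keeping matrices instead of classes explains the torus factors in later identities.
  Invertibility turns "at most one nonzero entry per row" into "exactly one".\<close>

definition monomial_Sp4 :: "('f::nonarch_local_field_char_0^4^4) set" where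
  "monomial_Sp4 = {w \<in> Sp4. \<forall>i. \<exists>j. \<forall>k. k \<noteq> j \<longrightarrow> w $ i $ k = 0}"

lemma monomial_Sp4 [simp, intro]: "w \<in> monomial_Sp4 \<Longrightarrow> w \<in> Sp4"
  by (simp add: monomial_Sp4_def)

lemma monomial_mult [simp, intro]:
  assumes "v \<in> monomial_Sp4" "w \<in> monomial_Sp4" shows "v ** w \<in> monomial_Sp4"
proof -
  have "\<exists>j. \<forall>k. k \<noteq> j \<longrightarrow> (v ** w) $ i $ k = 0" for i
  proof -
    obtain j where j: "\<And>k. k \<noteq> j \<Longrightarrow> v $ i $ k = 0"
      using assms(1) unfolding monomial_Sp4_def by blast
    obtain l where l: "\<And>k. k \<noteq> l \<Longrightarrow> w $ j $ k = 0"
      using assms(2) unfolding monomial_Sp4_def by blast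
    have "v $ i $ m * w $ m $ k = 0" if "k \<noteq> l" for k m
      using j[of m] l[of k] that by (cases "m = j") auto
    then have "(v ** w) $ i $ k = 0" if "k \<noteq> l" for k
      unfolding matrix_matrix_mult_def vec_lambda_beta using that by (intro sum.neutral) blast
    then show ?thesis by blast
  qed
  then show ?thesis
    using assms Sp4_mult[of v w] unfolding monomial_Sp4_def by blast
qed

lemma monomial_mat4:
  "mat4 a b c d e f g h i j k l m n p q \<in> monomial_Sp4 \<longleftrightarrow>
   mat4 a b c d e f g h i j k l m n p q \<in> Sp4 \<and>
   (b = 0 \<and> c = 0 \<and> d = 0 \<or> a = 0 \<and> c = 0 \<and> d = 0 \<or> a = 0 \<and> b = 0 \<and> d = 0 \<or> a = 0 \<and> b = 0 \<and> c = 0) \<and>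
   (f = 0 \<and> g = 0 \<and> h = 0 \<or> e = 0 \<and> g = 0 \<and> h = 0 \<or> e = 0 \<and> f = 0 \<and> h = 0 \<or> e = 0 \<and> f = 0 \<and> g = 0) \<and>
   (j = 0 \<and> k = 0 \<and> l = 0 \<or> i = 0 \<and> k = 0 \<and> l = 0 \<or> i = 0 \<and> j = 0 \<and> l = 0 \<or> i = 0 \<and> j = 0 \<and> k = 0) \<and>
   (n = 0 \<and> p = 0 \<and> q = 0 \<or> m = 0 \<and> p = 0 \<and> q = 0 \<or> m = 0 \<and> n = 0 \<and> q = 0 \<or> m = 0 \<and> n = 0 \<and> p = 0)"
proof -
  have ex4: "(\<exists>i::4. P i) \<longleftrightarrow> P 1 \<or> P 2 \<or> P 3 \<or> P 4" for P
    using exhaust_4 by metis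
  have row: "(\<exists>j. \<forall>k. k \<noteq> j \<longrightarrow> A $ r $ k = 0) \<longleftrightarrow>
      A$r$2 = 0 \<and> A$r$3 = 0 \<and> A$r$4 = 0 \<or> A$r$1 = 0 \<and> A$r$3 = 0 \<and> A$r$4 = 0 \<or>
      A$r$1 = 0 \<and> A$r$2 = 0 \<and> A$r$4 = 0 \<or> A$r$1 = 0 \<and> A$r$2 = 0 \<and> A$r$3 = 0"
    for A :: "'a^4^4" and r
    unfolding ex4 forall_4 by (simp only: distinct_indices4 simp_thms)
  show ?thesis
    unfolding monomial_Sp4_def mem_Collect_eq row unfolding forall_4 mat4_nth by blast
qed

definition torus :: "'f::field \<Rightarrow> 'f \<Rightarrow> 'f^4^4" where
  "torus a b = mat4 a 0 0 0 0 b 0 0 0 0 (inverse b) 0 0 0 0 (inverse a)"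

lemma torus_Sp4: "a \<noteq> 0 \<Longrightarrow> b \<noteq> 0 \<Longrightarrow> torus a b \<in> Sp4"
  by (simp add: torus_def Sp4_iff mat_one_mat4)

lemma torus_monomial: "a \<noteq> 0 \<Longrightarrow> b \<noteq> 0 \<Longrightarrow> torus a b \<in> monomial_Sp4"
  using torus_Sp4[of a b] by (simp add: torus_def monomial_mat4)

lemma torus_iwahori: "absval a = 1 \<Longrightarrow> absval b = 1 \<Longrightarrow> torus a b \<in> iwahori"
proof -
  assume *: "absval a = 1" "absval b = 1"
  then have "torus a b \<in> Sp4"
    by (intro torus_Sp4) auto
  with * show ?thesis
    by (simp add: torus_def iwahori_mat4 absval_inverse)
qed

text \<open>The position in row 1 determines row 4 and that in row 2 determines row 3, through
  \<open>w ** spinv w = mat 1\<close>. This leaves the eight elements of the Weyl group of type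
  C2.\<close>

lemma monomial_Sp4_cases:
  assumes "w \<in> monomial_Sp4"
  obtains a b c d where "a * d = 1" "b * c = 1" "w = mat4 a 0 0 0 0 b 0 0 0 0 c 0 0 0 0 d"
  | a b c d where "a * d = 1" "b * c = -1" "w = mat4 a 0 0 0 0 0 b 0 0 c 0 0 0 0 0 d"
  | a b c d where "a * d = 1" "b * c = 1" "w = mat4 0 a 0 0 b 0 0 0 0 0 0 c 0 0 d 0"
  | a b c d where "a * d = 1" "b * c = -1" "w = mat4 0 a 0 0 0 0 0 b c 0 0 0 0 0 d 0"
  | a b c d where "a * d = -1" "b * c = 1" "w = mat4 0 0 a 0 b 0 0 0 0 0 0 c 0 d 0 0"
  | a b c d where "a * d = -1" "b * c = -1" "w = mat4 0 0 a 0 0 0 0 b c 0 0 0 0 d 0 0"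
  | a b c d where "a * d = -1" "b * c = 1" "w = mat4 0 0 0 a 0 b 0 0 0 0 c 0 d 0 0 0"
  | a b c d where "a * d = -1" "b * c = -1" "w = mat4 0 0 0 a 0 0 b 0 0 c 0 0 d 0 0 0"
proof -
  obtain a1 a2 a3 a4 b1 b2 b3 b4 c1 c2 c3 c4 d1 d2 d3 d4
    where w: "w = mat4 a1 a2 a3 a4 b1 b2 b3 b4 c1 c2 c3 c4 d1 d2 d3 d4"
    using mat4_eta by blast
  have "w ** spinv w = mat 1"
    using assms by simp
  \<comment> \<open>Entries (1,1), (2,2), (1,2), (1,3) of the product. The first two give
    \<open>a * d\<close> and \<open>b * c\<close>; the last two say that row 1 is orthogonal to rows
    3 and 2.\<close>
  then have e: "a1 * d4 + a2 * d3 + a3 * - d2 + a4 * - d1 = 1" "b1 * c4 + b2 * c3 + b3 * - c2 + b4 * - c1 = 1"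
     "a1 * c4 + a2 * c3 + a3 * - c2 + a4 * - c1 = 0" "a1 * - b4 + a2 * - b3 + a3 * b2 + a4 * b1 = 0"
    unfolding w spinv_mat4 mat4_mult mat_one_mat4 mat4_eq_iff by blast+
  note mono = assms[unfolded w monomial_mat4, THEN conjunct2]
  note m = mono[THEN conjunct1] mono[THEN conjunct2, THEN conjunct1]
    mono[THEN conjunct2, THEN conjunct2, THEN conjunct1] mono[THEN conjunct2, THEN conjunct2, THEN conjunct2]
  have minus [simp]: "- x = 1 \<longleftrightarrow> x = -1" for x :: 'a
    by (metis minus_minus)
  show thesis
    using m(1)
  proof (elim disjE conjE)
    assume z: "a2 = 0" "a3 = 0" "a4 = 0"
    then have ad: "a1 * d4 = 1"
      using e(1) by simp
    then have nz: "a1 \<noteq> 0" "d4 \<noteq> 0" by auto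
    then have z2: "d1 = 0" "d2 = 0" "d3 = 0" "c4 = 0" "b4 = 0"
      using m(4) e(3,4) z by auto
    show thesis
      using m(2)
    proof (elim disjE conjE)
      assume y: "b2 = 0" "b3 = 0" "b4 = 0"
      then show thesis
        using e(2) z2 by simp
    next
      assume y: "b1 = 0" "b3 = 0" "b4 = 0"
      then have bc: "b2 * c3 = 1"
        using e(2) z2 by simp
      then have "c3 \<noteq> 0" by auto
      then have "c1 = 0" "c2 = 0" "c4 = 0"
        using m(3) by auto
      then show thesis
        using that(1)[OF ad bc] z z2 y by (simp add: w)
    next
      assume y: "b1 = 0" "b2 = 0" "b4 = 0"
      then have bc: "b3 * c2 = -1"
        using e(2) z2 by simp
      then have "c2 \<noteq> 0" by auto
      then have "c1 = 0" "c3 = 0" "c4 = 0"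
        using m(3) by auto
      then show thesis
        using that(2)[OF ad bc] z z2 y by (simp add: w)
    next
      assume y: "b1 = 0" "b2 = 0" "b3 = 0"
      then show thesis
        using e(2) z2 by simp
    qed
  next
    assume z: "a1 = 0" "a3 = 0" "a4 = 0"
    then have ad: "a2 * d3 = 1"
      using e(1) by simp
    then have nz: "a2 \<noteq> 0" "d3 \<noteq> 0" by auto
    then have z2: "d1 = 0" "d2 = 0" "d4 = 0" "c3 = 0" "b3 = 0"
      using m(4) e(3,4) z by auto
    show thesis
      using m(2)
    proof (elim disjE conjE)
      assume y: "b2 = 0" "b3 = 0" "b4 = 0"
      then have bc: "b1 * c4 = 1"
        using e(2) z2 by simp
      then have "c4 \<noteq> 0" by auto
      then have "c1 = 0" "c2 = 0" "c3 = 0"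
        using m(3) by auto
      then show thesis
        using that(3)[OF ad bc] z z2 y by (simp add: w)
    next
      assume y: "b1 = 0" "b3 = 0" "b4 = 0"
      then show thesis
        using e(2) z2 by simp
    next
      assume y: "b1 = 0" "b2 = 0" "b4 = 0"
      then show thesis
        using e(2) z2 by simp
    next
      assume y: "b1 = 0" "b2 = 0" "b3 = 0"
      then have bc: "b4 * c1 = -1"
        using e(2) z2 by simp
      then have "c1 \<noteq> 0" by auto
      then have "c2 = 0" "c3 = 0" "c4 = 0"
        using m(3) by auto
      then show thesis
        using that(4)[OF ad bc] z z2 y by (simp add: w)
    qed
  next
    assume z: "a1 = 0" "a2 = 0" "a4 = 0"
    then have ad: "a3 * d2 = -1"
      using e(1) by simp
    then have nz: "a3 \<noteq> 0" "d2 \<noteq> 0" by auto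
    then have z2: "d1 = 0" "d3 = 0" "d4 = 0" "c2 = 0" "b2 = 0"
      using m(4) e(3,4) z by auto
    show thesis
      using m(2)
    proof (elim disjE conjE)
      assume y: "b2 = 0" "b3 = 0" "b4 = 0"
      then have bc: "b1 * c4 = 1"
        using e(2) z2 by simp
      then have "c4 \<noteq> 0" by auto
      then have "c1 = 0" "c2 = 0" "c3 = 0"
        using m(3) by auto
      then show thesis
        using that(5)[OF ad bc] z z2 y by (simp add: w)
    next
      assume y: "b1 = 0" "b3 = 0" "b4 = 0"
      then show thesis
        using e(2) z2 by simp
    next
      assume y: "b1 = 0" "b2 = 0" "b4 = 0"
      then show thesis
        using e(2) z2 by simp
    next
      assume y: "b1 = 0" "b2 = 0" "b3 = 0"
      then have bc: "b4 * c1 = -1"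
        using e(2) z2 by simp
      then have "c1 \<noteq> 0" by auto
      then have "c2 = 0" "c3 = 0" "c4 = 0"
        using m(3) by auto
      then show thesis
        using that(6)[OF ad bc] z z2 y by (simp add: w)
    qed
  next
    assume z: "a1 = 0" "a2 = 0" "a3 = 0"
    then have ad: "a4 * d1 = -1"
      using e(1) by simp
    then have nz: "a4 \<noteq> 0" "d1 \<noteq> 0" by auto
    then have z2: "d2 = 0" "d3 = 0" "d4 = 0" "c1 = 0" "b1 = 0"
      using m(4) e(3,4) z by auto
    show thesis
      using m(2)
    proof (elim disjE conjE)
      assume y: "b2 = 0" "b3 = 0" "b4 = 0"
      then show thesis
        using e(2) z2 by simp
    next
      assume y: "b1 = 0" "b3 = 0" "b4 = 0"
      then have bc: "b2 * c3 = 1"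
        using e(2) z2 by simp
      then have "c3 \<noteq> 0" by auto
      then have "c1 = 0" "c2 = 0" "c4 = 0"
        using m(3) by auto
      then show thesis
        using that(7)[OF ad bc] z z2 y by (simp add: w)
    next
      assume y: "b1 = 0" "b2 = 0" "b4 = 0"
      then have bc: "b3 * c2 = -1"
        using e(2) z2 by simp
      then have "c2 \<noteq> 0" by auto
      then have "c1 = 0" "c3 = 0" "c4 = 0"
        using m(3) by auto
      then show thesis
        using that(8)[OF ad bc] z z2 y by (simp add: w)
    next
      assume y: "b1 = 0" "b2 = 0" "b3 = 0"
      then show thesis
        using e(2) z2 by simp
    qed
  qed
qed

subsection \<open>Simple reflections\<close>

lemma mat4_cases:
  obtains a b c d e f g h i j k l m n p q where "A = mat4 a b c d e f g h i j k l m n p q"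
  using mat4_eta by blast

text \<open>Here \<open>x\<close> parametrizes the affine root group of \<open>s\<close>.  The assumption \<open>dichotomy\<close> says that
  \<open>spinv w\<close> or \<open>spinv (s ** w)\<close> takes the affine root of \<open>s\<close> to a positive one; it replaces the
  length function of the affine Weyl group.\<close>

locale simple_reflection =
  fixes s :: "'f::nonarch_local_field_char_0^4^4" and x :: "'f \<Rightarrow> 'f^4^4"
  assumes s_monomial [simp]: "s \<in> monomial_Sp4"
    and x_Sp4 [simp]: "x t \<in> Sp4"
    and x_add: "x (t + u) = x t ** x u"
    and x_iwahori [simp]: "absval t \<le> 1 \<Longrightarrow> x t \<in> iwahori"
    and x_conj_iwahori: "absval t \<le> 1 \<Longrightarrow> s ** x t ** spinv s \<in> iwahori \<longleftrightarrow> absval t < 1"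
    and s_square [simp]: "s ** s \<in> iwahori"
    and iwahori_factor: "h \<in> iwahori \<Longrightarrow> \<exists>t. absval t \<le> 1 \<and> s ** (h ** x t) ** spinv s \<in> iwahori"
    and x_conj_unit: "absval t = 1 \<Longrightarrow> \<exists>t1 z t2. absval t1 \<le> 1 \<and> absval t2 \<le> 1 \<and>
          z \<in> iwahori \<inter> monomial_Sp4 \<and> s ** x t ** spinv s = x t1 ** s ** z ** x t2"
    and dichotomy: "w \<in> monomial_Sp4 \<Longrightarrow>
          (\<forall>t. absval t \<le> 1 \<longrightarrow> spinv w ** x t ** w \<in> iwahori) \<or>
          (\<forall>t. absval t \<le> 1 \<longrightarrow> spinv (s ** w) ** x t ** (s ** w) \<in> iwahori)"
begin

lemma s_Sp4 [simp]: "s \<in> Sp4"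
  by simp

lemma x_zero: "x 0 = mat 1"
proof -
  have "spinv (x 0) ** x (0 + 0) = x 0"
    unfolding x_add by (simp add: mat_simps)
  then show ?thesis by simp
qed

lemma spinv_x: "spinv (x t) = x (- t)"
proof -
  have "spinv (x t) ** (x t ** x (- t)) = spinv (x t)"
    by (simp add: x_add[symmetric] x_zero mat_simps)
  then show ?thesis
    by (simp add: mat_simps)
qed

text \<open>Conjugation by \<open>s\<close> and by its inverse differ by conjugation by
  \<open>s ** s\<close>, an Iwahori element.\<close>

lemma conj_iwahori_swap:
  assumes "h \<in> Sp4"
  shows "spinv s ** h ** s \<in> iwahori \<longleftrightarrow> s ** h ** spinv s \<in> iwahori"
proof
  assume "spinv s ** h ** s \<in> iwahori"
  then have "(s ** s) ** (spinv s ** h ** s) ** spinv (s ** s) \<in> iwahori"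
    by (rule iwahori_mult[OF iwahori_mult[OF s_square] iwahori_spinv[OF s_square]])
  then show "s ** h ** spinv s \<in> iwahori"
    by (simp add: mat_simps del: s_square)
next
  assume "s ** h ** spinv s \<in> iwahori"
  then have "spinv (s ** s) ** (s ** h ** spinv s) ** (s ** s) \<in> iwahori"
    by (rule iwahori_mult[OF iwahori_mult[OF iwahori_spinv[OF s_square]] s_square])
  then show "spinv s ** h ** s \<in> iwahori"
    by (simp add: mat_simps del: s_square)
qed

text \<open>The BN-pair axiom for \<open>s\<close>. Write \<open>h\<close> as a part that
  \<open>s\<close> conjugates into the Iwahori subgroup, times \<open>x (- t)\<close>. The latter is
  absorbed by \<open>w\<close> on the right, or by \<open>s\<close> on the left, or, for a unit
  \<open>t\<close>, rewritten by the rank-one identity so that \<open>s ** w\<close> absorbs what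
  remains.\<close>

lemma double_coset_closed:
  assumes h: "h \<in> iwahori" and w: "w \<in> monomial_Sp4"
  obtains h' w' h'' where "h' \<in> iwahori" "w' \<in> monomial_Sp4" "h'' \<in> iwahori"
    "s ** h ** w = h' ** w' ** h''"
proof -
  from iwahori_factor[OF h] obtain t where t: "absval t \<le> 1"
    and k: "s ** (h ** x t) ** spinv s \<in> iwahori" by blast
  define k where "k = s ** (h ** x t) ** spinv s"
  have shw: "s ** h ** w = k ** s ** x (- t) ** w"
    unfolding k_def spinv_x[symmetric] using h by (simp add: mat_simps)
  from dichotomy[OF w] show thesis
  proof
    assume "\<forall>t. absval t \<le> 1 \<longrightarrow> spinv w ** x t ** w \<in> iwahori"
    then have "spinv w ** x (- t) ** w \<in> iwahori"
      using t by simp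
    moreover have "s ** h ** w = k ** (s ** w) ** (spinv w ** x (- t) ** w)"
      unfolding shw using w by (simp add: mat_simps)
    ultimately show thesis
      using k w unfolding k_def[symmetric] by (intro that[of k "s ** w"]) simp_all
  next
    assume *: "\<forall>t. absval t \<le> 1 \<longrightarrow> spinv (s ** w) ** x t ** (s ** w) \<in> iwahori"
    show thesis
    proof (cases "absval t < 1")
      case True
      then have "s ** x (- t) ** spinv s \<in> iwahori"
        using x_conj_iwahori[of "- t"] by simp
      moreover have "s ** h ** w = (k ** (s ** x (- t) ** spinv s)) ** (s ** w) ** mat 1"
        unfolding shw by (simp add: mat_simps)
      ultimately show thesis
        using k w unfolding k_def[symmetric]
        by (intro that[of "k ** (s ** x (- t) ** spinv s)" "s ** w" "mat 1"]) simp_all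
    next
      case False
      then obtain t1 z t2 where t12: "absval t1 \<le> 1" "absval t2 \<le> 1"
        and z: "z \<in> iwahori" "z \<in> monomial_Sp4"
        and e: "s ** x (- t) ** spinv s = x t1 ** s ** z ** x t2"
        using x_conj_unit[of "- t"] t by auto
      have "s ** h ** w = k ** (s ** x (- t) ** spinv s) ** s ** w"
        unfolding shw by (simp add: mat_simps)
      also have "\<dots> = (k ** x t1) ** (s ** z ** s ** w) ** (spinv (s ** w) ** x t2 ** (s ** w))"
        unfolding e using w z by (simp add: mat_simps)
      finally show thesis
        using k w z t12 * unfolding k_def[symmetric]
        by (intro that[of "k ** x t1" "s ** z ** s ** w" "spinv (s ** w) ** x t2 ** (s ** w)"]) simp_all
    qed
  qed
qed

end

subsection \<open>The generators of the affine Weyl group\<close>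

definition s1 :: "'f::field^4^4" where
  "s1 = mat4 0 1 0 0 (-1) 0 0 0 0 0 0 (-1) 0 0 1 0"

definition s2 :: "'f::field^4^4" where
  "s2 = mat4 1 0 0 0 0 0 1 0 0 (-1) 0 0 0 0 0 1"

definition x1 :: "'f::field \<Rightarrow> 'f^4^4" where
  "x1 t = mat4 1 t 0 0 0 1 0 0 0 0 1 (- t) 0 0 0 1"

definition x2 :: "'f::field \<Rightarrow> 'f^4^4" where
  "x2 t = mat4 1 0 0 0 0 1 t 0 0 0 1 0 0 0 0 1"

text \<open>Of an affine root and its negative one is positive; the dichotomy of the locale comes
  from here.\<close>

lemma absval_le_or_less:
  assumes "a * b = 1 \<or> a * b = -1"
  shows "absval a \<le> 1 \<or> absval b < 1"
proof (rule ccontr)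
  assume "\<not> ?thesis"
  then have "absval a > 1" "absval b \<ge> 1" by auto
  then have "absval (a * b) > 1"
    unfolding absval_mult by (metis less_le_trans less_1_mult linorder_not_le mult.right_neutral order.order_iff_strict)
  then show False using assms by auto
qed

text \<open>Modulo the maximal ideal \<open>h\<close> is upper triangular, so the diagonal of
  \<open>spinv h ** h = mat 1\<close> reduces to products of two diagonal entries of
  \<open>h\<close>.\<close>

lemma iwahori_diagonal_units:
  assumes "h \<in> iwahori"
  shows "absval (h$1$1) = 1" "absval (h$2$2) = 1" "absval (h$3$3) = 1" "absval (h$4$4) = 1"
proof -
  note h = assms[unfolded iwahori_iff]
  have "spinv h ** h = mat 1"
    using assms by simp
  then have e: "h$4$4 * h$1$1 + h$3$4 * h$2$1 + - h$2$4 * h$3$1 + - h$1$4 * h$4$1 = 1"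
     "h$4$3 * h$1$2 + h$3$3 * h$2$2 + - h$2$3 * h$3$2 + - h$1$3 * h$4$2 = 1"
    by (subst (asm) (1 2) mat4_eta[of h], unfold spinv_mat4 mat4_mult mat_one_mat4 mat4_eq_iff, blast)+
  have "absval (- (h$3$4 * h$2$1) + h$2$4 * h$3$1 + h$1$4 * h$4$1) < 1"
    using h by (intro absval_add_less) (simp_all add: absval_mult_less_right)
  moreover have "h$4$4 * h$1$1 - 1 = - (h$3$4 * h$2$1) + h$2$4 * h$3$1 + h$1$4 * h$4$1"
    by (subst e(1)[symmetric]) (simp add: algebra_simps)
  ultimately have 1: "absval (h$4$4 * h$1$1 - 1) < 1" by simp
  have "absval (- (h$4$3 * h$1$2) + h$2$3 * h$3$2 + h$1$3 * h$4$2) < 1"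
    using h by (intro absval_add_less) (simp_all add: absval_mult_less_right absval_mult_less_left)
  moreover have "h$3$3 * h$2$2 - 1 = - (h$4$3 * h$1$2) + h$2$3 * h$3$2 + h$1$3 * h$4$2"
    by (subst e(2)[symmetric]) (simp add: algebra_simps)
  ultimately have 2: "absval (h$3$3 * h$2$2 - 1) < 1" by simp
  show "absval (h$1$1) = 1" "absval (h$2$2) = 1" "absval (h$3$3) = 1" "absval (h$4$4) = 1"
    using absval_eq_one_of_near_one[of "h$4$4" "h$1$1"] absval_eq_one_of_near_one[of "h$1$1" "h$4$4"]
      absval_eq_one_of_near_one[of "h$3$3" "h$2$2"] absval_eq_one_of_near_one[of "h$2$2" "h$3$3"] h 1 2
    by (simp_all add: mult.commute)
qed

text \<open>The long simple root: everything happens in the copy of SL2 on the two middle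
  coordinates.\<close>

interpretation r2: simple_reflection "s2 :: 'f::nonarch_local_field_char_0^4^4" x2
proof
  have sS: "(s2 :: 'f^4^4) \<in> Sp4"
    by (simp add: s2_def Sp4_iff mat_one_mat4)
  then show sm: "(s2 :: 'f^4^4) \<in> monomial_Sp4"
    unfolding s2_def by (simp add: monomial_mat4)
  show xS: "x2 t \<in> Sp4" for t :: 'f
    by (simp add: x2_def Sp4_iff mat_one_mat4)
  show "x2 (t + u) = x2 t ** x2 u" for t u :: 'f
    by (simp add: x2_def add.commute)
  show xI: "x2 t \<in> iwahori" if "absval t \<le> 1" for t :: 'f
    using xS[of t] that by (simp add: x2_def iwahori_mat4)
  show "s2 ** x2 t ** spinv s2 \<in> iwahori \<longleftrightarrow> absval t < 1" if "absval t \<le> 1" for t :: 'f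
  proof -
    have "s2 ** x2 t ** spinv s2 \<in> Sp4"
      using sS xS by simp
    then show ?thesis
      by (simp add: x2_def s2_def iwahori_mat4)
  qed
  have "s2 ** (s2 :: 'f^4^4) \<in> Sp4"
    using sS by simp
  then show "s2 ** (s2 :: 'f^4^4) \<in> iwahori"
    by (simp add: s2_def iwahori_mat4)
  show "\<exists>t. absval t \<le> 1 \<and> s2 ** (h ** x2 t) ** spinv s2 \<in> iwahori" if h: "h \<in> iwahori" for h :: "'f^4^4"
  proof (intro exI conjI)
    \<comment> \<open>Clears entry (2,3), the only one that conjugation by \<open>s2\<close> moves
      from above the diagonal to below it.\<close>
    define t where "t = - (h$2$3 / h$2$2)"
    show "absval t \<le> 1"
      using h iwahori_diagonal_units[OF h] by (simp add: t_def absval_divide iwahori_iff)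
    then have k: "h ** x2 t \<in> iwahori"
      using h xI by simp
    define k where "k = h ** x2 t"
    have "h$2$2 \<noteq> 0"
      using iwahori_diagonal_units(2)[OF h] by auto
    then have "k$2$3 = 0"
      unfolding k_def by (subst mat4_eta[of h]) (simp add: x2_def t_def)
    moreover have "s2 ** k ** spinv s2 \<in> Sp4"
      using sS k by (simp add: k_def)
    ultimately show "s2 ** (h ** x2 t) ** spinv s2 \<in> iwahori"
      using k mat4_eta[of k] unfolding k_def[symmetric]
      by (cases k rule: mat4_cases) (simp add: s2_def iwahori_mat4)
  qed
  show "\<exists>t1 z t2. absval t1 \<le> 1 \<and> absval t2 \<le> 1 \<and> z \<in> iwahori \<inter> monomial_Sp4 \<and>
      s2 ** x2 t ** spinv s2 = x2 t1 ** s2 ** z ** x2 t2" if t: "absval t = 1" for t :: 'f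
  proof (intro exI conjI)
    have t0: "t \<noteq> 0" using t by auto
    \<comment> \<open>A lower unipotent matrix of SL2 with a unit below the diagonal is in the big
      cell: (1 0; -t 1) = (1 -1/t; 0 1) s (t 0; 0 1/t) (1 -1/t; 0 1).\<close>
    show "absval (- inverse t) \<le> 1" "absval (- inverse t) \<le> 1"
      using t by (simp_all add: absval_inverse)
    show "torus 1 t \<in> iwahori \<inter> monomial_Sp4"
      using t t0 by (simp add: torus_iwahori torus_monomial absval_inverse)
    show "s2 ** x2 t ** spinv s2 = x2 (- inverse t) ** s2 ** torus 1 t ** x2 (- inverse t)"
      using t0 by (simp add: s2_def x2_def torus_def)
  qed
  \<comment> \<open>The conjugates are root group elements whose entry is, up to sign,
    \<open>t\<close> times the square of the nonzero entry in row 3 of \<open>w\<close>,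
    respectively row 2. The product of these two entries is 1 or -1.\<close>
  show "(\<forall>t. absval t \<le> 1 \<longrightarrow> spinv w ** x2 t ** w \<in> iwahori) \<or>
      (\<forall>t. absval t \<le> 1 \<longrightarrow> spinv (s2 ** w) ** x2 t ** (s2 ** w) \<in> iwahori)"
    if w: "w \<in> monomial_Sp4" for w :: "'f^4^4"
  proof -
    have S: "spinv w ** x2 t ** w \<in> Sp4" "spinv (s2 ** w) ** x2 t ** (s2 ** w) \<in> Sp4" for t
      using w sS xS by (meson Sp4_mult spinv_Sp4 monomial_Sp4)+
    show ?thesis
      using w
    proof (cases rule: monomial_Sp4_cases)
      case (1 a b c d)
      with absval_le_or_less[of c b] absval_le_or_less[of b c] S show ?thesis
        unfolding 1(3) x2_def s2_def
        by (auto simp: iwahori_mat4 mult.commute intro!: absval_mult_le absval_mult_less_left)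
    next
      case (2 a b c d)
      with absval_le_or_less[of c b] absval_le_or_less[of b c] S show ?thesis
        unfolding 2(3) x2_def s2_def
        by (auto simp: iwahori_mat4 mult.commute intro!: absval_mult_le absval_mult_less_left)
    next
      case (3 a b c d)
      with absval_le_or_less[of c b] absval_le_or_less[of b c] S show ?thesis
        unfolding 3(3) x2_def s2_def
        by (auto simp: iwahori_mat4 mult.commute intro!: absval_mult_le absval_mult_less_left)
    next
      case (4 a b c d)
      with absval_le_or_less[of c b] absval_le_or_less[of b c] S show ?thesis
        unfolding 4(3) x2_def s2_def
        by (auto simp: iwahori_mat4 mult.commute intro!: absval_mult_le absval_mult_less_left)
    next
      case (5 a b c d)
      with absval_le_or_less[of c b] absval_le_or_less[of b c] S show ?thesis
        unfolding 5(3) x2_def s2_def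
        by (auto simp: iwahori_mat4 mult.commute intro!: absval_mult_le absval_mult_less_left)
    next
      case (6 a b c d)
      with absval_le_or_less[of c b] absval_le_or_less[of b c] S show ?thesis
        unfolding 6(3) x2_def s2_def
        by (auto simp: iwahori_mat4 mult.commute intro!: absval_mult_le absval_mult_less_left)
    next
      case (7 a b c d)
      with absval_le_or_less[of c b] absval_le_or_less[of b c] S show ?thesis
        unfolding 7(3) x2_def s2_def
        by (auto simp: iwahori_mat4 mult.commute intro!: absval_mult_le absval_mult_less_left)
    next
      case (8 a b c d)
      with absval_le_or_less[of c b] absval_le_or_less[of b c] S show ?thesis
        unfolding 8(3) x2_def s2_def
        by (auto simp: iwahori_mat4 mult.commute intro!: absval_mult_le absval_mult_less_left)
    qed
  qed
qed

lemma absval_mult_le_or_less: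
  assumes "a * d = 1 \<or> a * d = -1" "b * c = 1 \<or> b * c = -1"
  shows "absval (a * b) \<le> 1 \<or> absval (c * d) < 1"
proof (rule absval_le_or_less)
  have *: "a * b * (c * d) = (a * d) * (b * c)"
    by (simp add: mult_ac)
  show "a * b * (c * d) = 1 \<or> a * b * (c * d) = - 1"
    unfolding * using assms by auto
qed

interpretation r1: simple_reflection "s1 :: 'f::nonarch_local_field_char_0^4^4" x1
proof
  have sS: "(s1 :: 'f^4^4) \<in> Sp4"
    by (simp add: s1_def Sp4_iff mat_one_mat4)
  then show sm: "(s1 :: 'f^4^4) \<in> monomial_Sp4"
    unfolding s1_def by (simp add: monomial_mat4)
  show xS: "x1 t \<in> Sp4" for t :: 'f
    by (simp add: x1_def Sp4_iff mat_one_mat4)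
  show "x1 (t + u) = x1 t ** x1 u" for t u :: 'f
    by (simp add: x1_def add.commute)
  show xI: "x1 t \<in> iwahori" if "absval t \<le> 1" for t :: 'f
    using xS[of t] that by (simp add: x1_def iwahori_mat4)
  show "s1 ** x1 t ** spinv s1 \<in> iwahori \<longleftrightarrow> absval t < 1" if "absval t \<le> 1" for t :: 'f
  proof -
    have "s1 ** x1 t ** spinv s1 \<in> Sp4"
      using sS xS by simp
    then show ?thesis
      by (simp add: x1_def s1_def iwahori_mat4)
  qed
  have "s1 ** (s1 :: 'f^4^4) \<in> Sp4"
    using sS by simp
  then show "s1 ** (s1 :: 'f^4^4) \<in> iwahori"
    by (simp add: s1_def iwahori_mat4)
  show "\<exists>t. absval t \<le> 1 \<and> s1 ** (h ** x1 t) ** spinv s1 \<in> iwahori" if h: "h \<in> iwahori" for h :: "'f^4^4"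
  proof (intro exI conjI)
    define t where "t = - (h$1$2 / h$1$1)"
    show "absval t \<le> 1"
      using h iwahori_diagonal_units[OF h] by (simp add: t_def absval_divide iwahori_iff)
    then have k: "h ** x1 t \<in> iwahori"
      using h xI by simp
    define k where "k = h ** x1 t"
    have "h$1$1 \<noteq> 0"
      using iwahori_diagonal_units(1)[OF h] by auto
    then have k12: "k$1$2 = 0"
      unfolding k_def by (subst mat4_eta[of h]) (simp add: x1_def t_def)
    \<comment> \<open>Conjugation by \<open>s1\<close> moves both (1,2) and (3,4) below the
      diagonal. The choice of \<open>t\<close> clears the first; the symplectic relations then make
      the second small.\<close>
    have "spinv k ** k = mat 1"
      using k by (simp add: k_def)
    then have "k$4$3 * k$1$4 + k$3$3 * k$2$4 + - k$2$3 * k$3$4 + - k$1$3 * k$4$4 = 0"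
        "k$4$4 * k$1$2 + k$3$4 * k$2$2 + - k$2$4 * k$3$2 + - k$1$4 * k$4$2 = 0"
      by (subst (asm) (1 2) mat4_eta[of k], unfold spinv_mat4 mat4_mult mat_one_mat4 mat4_eq_iff, blast)+
    then have "k$3$4 * k$2$2 = k$2$4 * k$3$2 + k$1$4 * k$4$2"
      using k12 by (simp add: algebra_simps add_eq_0_iff)
    moreover have "absval (k$2$4 * k$3$2 + k$1$4 * k$4$2) < 1"
      using k unfolding k_def[symmetric] iwahori_iff
      by (intro absval_add_less absval_mult_less_right) simp_all
    ultimately have "absval (k$3$4 * k$2$2) < 1"
      by simp
    then have "absval (k$3$4) < 1"
      using iwahori_diagonal_units(2)[of k] k by (simp add: k_def absval_mult)
    moreover have "s1 ** k ** spinv s1 \<in> Sp4"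
      using sS k by (simp add: k_def)
    ultimately show "s1 ** (h ** x1 t) ** spinv s1 \<in> iwahori"
      using k k12 unfolding k_def[symmetric]
      by (cases k rule: mat4_cases) (simp add: s1_def iwahori_mat4)
  qed
  show "\<exists>t1 z t2. absval t1 \<le> 1 \<and> absval t2 \<le> 1 \<and> z \<in> iwahori \<inter> monomial_Sp4 \<and>
      s1 ** x1 t ** spinv s1 = x1 t1 ** s1 ** z ** x1 t2" if t: "absval t = 1" for t :: 'f
  proof (intro exI conjI)
    have t0: "t \<noteq> 0" using t by auto
    show "absval (- inverse t) \<le> 1" "absval (- inverse t) \<le> 1"
      using t by (simp_all add: absval_inverse)
    show "torus t (inverse t) \<in> iwahori \<inter> monomial_Sp4"
      using t t0 by (simp add: torus_iwahori torus_monomial absval_inverse)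
    show "s1 ** x1 t ** spinv s1 = x1 (- inverse t) ** s1 ** torus t (inverse t) ** x1 (- inverse t)"
      using t0 by (simp add: s1_def x1_def torus_def)
  qed
  \<comment> \<open>Here the entries are \<open>t\<close> times products of two entries of
    \<open>w\<close>. Whether \<open>w\<close> gets the weak or the strict bound depends on whether
    its inverse takes the finite root to a positive or a negative one.\<close>
  show "(\<forall>t. absval t \<le> 1 \<longrightarrow> spinv w ** x1 t ** w \<in> iwahori) \<or>
      (\<forall>t. absval t \<le> 1 \<longrightarrow> spinv (s1 ** w) ** x1 t ** (s1 ** w) \<in> iwahori)"
    if w: "w \<in> monomial_Sp4" for w :: "'f^4^4"
  proof -
    have S: "spinv w ** x1 t ** w \<in> Sp4" "spinv (s1 ** w) ** x1 t ** (s1 ** w) \<in> Sp4" for t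
      using w sS xS by (meson Sp4_mult spinv_Sp4 monomial_Sp4)+
    show ?thesis
      using w
    proof (cases rule: monomial_Sp4_cases)
      case (1 a b c d)
      then have "absval (d * b) \<le> 1 \<or> absval (c * a) < 1"
        by (intro absval_mult_le_or_less) (simp_all add: mult.commute)
      then show ?thesis
      proof
        assume "absval (d * b) \<le> 1"
        then show ?thesis
          using S(1) absval_mult_le[of _ "d * b"] 1(1,2) unfolding 1(3)
          by (intro disjI1) (simp add: x1_def iwahori_mat4 mult_ac)
      next
        assume "absval (c * a) < 1"
        then show ?thesis
          using S(2) absval_mult_less_right[of _ "c * a"] 1(1,2) unfolding 1(3)
          by (intro disjI2) (simp add: x1_def s1_def iwahori_mat4 mult_ac)
      qed
    next
      case (2 a b c d)
      then have "absval (d * b) \<le> 1 \<or> absval (c * a) < 1"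
        by (intro absval_mult_le_or_less) (simp_all add: mult.commute)
      then show ?thesis
      proof
        assume "absval (d * b) \<le> 1"
        then show ?thesis
          using S(1) absval_mult_le[of _ "d * b"] 2(1,2) unfolding 2(3)
          by (intro disjI1) (simp add: x1_def iwahori_mat4 mult_ac)
      next
        assume "absval (c * a) < 1"
        then show ?thesis
          using S(2) absval_mult_less_right[of _ "c * a"] 2(1,2) unfolding 2(3)
          by (intro disjI2) (simp add: x1_def s1_def iwahori_mat4 mult_ac)
      qed
    next
      case (3 a b c d)
      then have "absval (a * c) \<le> 1 \<or> absval (b * d) < 1"
        by (intro absval_mult_le_or_less) (simp_all add: mult.commute)
      then show ?thesis
      proof (rule disjE)
        assume "absval (b * d) < 1"
        then show ?thesis
          using S(1) absval_mult_less_right[of _ "b * d"] 3(1,2) unfolding 3(3)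
          by (intro disjI1) (simp add: x1_def iwahori_mat4 mult_ac)
      next
        assume "absval (a * c) \<le> 1"
        then show ?thesis
          using S(2) absval_mult_le[of _ "a * c"] 3(1,2) unfolding 3(3)
          by (intro disjI2) (simp add: x1_def s1_def iwahori_mat4 mult_ac)
      qed
    next
      case (4 a b c d)
      then have "absval (d * b) \<le> 1 \<or> absval (c * a) < 1"
        by (intro absval_mult_le_or_less) (simp_all add: mult.commute)
      then show ?thesis
      proof
        assume "absval (d * b) \<le> 1"
        then show ?thesis
          using S(1) absval_mult_le[of _ "d * b"] 4(1,2) unfolding 4(3)
          by (intro disjI1) (simp add: x1_def iwahori_mat4 mult_ac)
      next
        assume "absval (c * a) < 1"
        then show ?thesis
          using S(2) absval_mult_less_right[of _ "c * a"] 4(1,2) unfolding 4(3)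
          by (intro disjI2) (simp add: x1_def s1_def iwahori_mat4 mult_ac)
      qed
    next
      case (5 a b c d)
      then have "absval (a * c) \<le> 1 \<or> absval (b * d) < 1"
        by (intro absval_mult_le_or_less) (simp_all add: mult.commute)
      then show ?thesis
      proof (rule disjE)
        assume "absval (b * d) < 1"
        then show ?thesis
          using S(1) absval_mult_less_right[of _ "b * d"] 5(1,2) unfolding 5(3)
          by (intro disjI1) (simp add: x1_def iwahori_mat4 mult_ac)
      next
        assume "absval (a * c) \<le> 1"
        then show ?thesis
          using S(2) absval_mult_le[of _ "a * c"] 5(1,2) unfolding 5(3)
          by (intro disjI2) (simp add: x1_def s1_def iwahori_mat4 mult_ac)
      qed
    next
      case (6 a b c d)
      then have "absval (d * b) \<le> 1 \<or> absval (c * a) < 1"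
        by (intro absval_mult_le_or_less) (simp_all add: mult.commute)
      then show ?thesis
      proof
        assume "absval (d * b) \<le> 1"
        then show ?thesis
          using S(1) absval_mult_le[of _ "d * b"] 6(1,2) unfolding 6(3)
          by (intro disjI1) (simp add: x1_def iwahori_mat4 mult_ac)
      next
        assume "absval (c * a) < 1"
        then show ?thesis
          using S(2) absval_mult_less_right[of _ "c * a"] 6(1,2) unfolding 6(3)
          by (intro disjI2) (simp add: x1_def s1_def iwahori_mat4 mult_ac)
      qed
    next
      case (7 a b c d)
      then have "absval (a * c) \<le> 1 \<or> absval (b * d) < 1"
        by (intro absval_mult_le_or_less) (simp_all add: mult.commute)
      then show ?thesis
      proof (rule disjE)
        assume "absval (b * d) < 1"
        then show ?thesis
          using S(1) absval_mult_less_right[of _ "b * d"] 7(1,2) unfolding 7(3)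
          by (intro disjI1) (simp add: x1_def iwahori_mat4 mult_ac)
      next
        assume "absval (a * c) \<le> 1"
        then show ?thesis
          using S(2) absval_mult_le[of _ "a * c"] 7(1,2) unfolding 7(3)
          by (intro disjI2) (simp add: x1_def s1_def iwahori_mat4 mult_ac)
      qed
    next
      case (8 a b c d)
      then have "absval (a * c) \<le> 1 \<or> absval (b * d) < 1"
        by (intro absval_mult_le_or_less) (simp_all add: mult.commute)
      then show ?thesis
      proof (rule disjE)
        assume "absval (b * d) < 1"
        then show ?thesis
          using S(1) absval_mult_less_right[of _ "b * d"] 8(1,2) unfolding 8(3)
          by (intro disjI1) (simp add: x1_def iwahori_mat4 mult_ac)
      next
        assume "absval (a * c) \<le> 1"
        then show ?thesis
          using S(2) absval_mult_le[of _ "a * c"] 8(1,2) unfolding 8(3)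
          by (intro disjI2) (simp add: x1_def s1_def iwahori_mat4 mult_ac)
      qed
    qed
  qed
qed

subsection \<open>The outer automorphism exchanging the two hyperspecial vertices\<close>

text \<open>Conjugation by the similitude of multiplier \<open>- uniformizer\<close> that maps the basis
  \<open>e\<^sub>1, e\<^sub>2, e\<^sub>3, e\<^sub>4\<close> to \<open>w e\<^sub>3, w e\<^sub>4, e\<^sub>1, e\<^sub>2\<close>, where \<open>w\<close> is the uniformizer; it normalizes the
  Iwahori subgroup.\<close>

definition theta :: "'f::nonarch_local_field_char_0^4^4 \<Rightarrow> 'f^4^4" where
  "theta g = mat4 (g$3$3) (g$3$4) (g$3$1 / uniformizer) (g$3$2 / uniformizer)
                  (g$4$3) (g$4$4) (g$4$1 / uniformizer) (g$4$2 / uniformizer)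
                  (uniformizer * g$1$3) (uniformizer * g$1$4) (g$1$1) (g$1$2)
                  (uniformizer * g$2$3) (uniformizer * g$2$4) (g$2$1) (g$2$2)"

lemma theta_mat4:
  "theta (mat4 a b c d e f g h i j k l m n p q) =
   mat4 k l (i / uniformizer) (j / uniformizer) p q (m / uniformizer) (n / uniformizer)
        (uniformizer * c) (uniformizer * d) a b (uniformizer * g) (uniformizer * h) e f"
  by (simp add: theta_def)

lemma theta_theta [simp]: "theta (theta g) = g"
  by (cases g rule: mat4_cases) (simp add: theta_mat4)

lemma theta_mult: "theta (g ** h) = theta g ** theta h"
  by (cases g rule: mat4_cases, cases h rule: mat4_cases) (simp add: theta_mat4 algebra_simps add_divide_distrib)

lemma theta_spinv: "theta (spinv g) = spinv (theta g)"
  by (cases g rule: mat4_cases) (simp add: theta_mat4)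

lemma theta_mat_1 [simp]: "theta (mat 1) = mat 1"
  by (simp add: mat_one_mat4 theta_mat4)

lemma theta_Sp4 [simp]: "theta g \<in> Sp4 \<longleftrightarrow> g \<in> Sp4"
proof -
  have "theta h \<in> Sp4" if "h \<in> Sp4" for h :: "'a^4^4"
    using that by (simp add: Sp4_iff theta_spinv[symmetric] theta_mult[symmetric])
  from this[of g] this[of "theta g"] show ?thesis by auto
qed

lemma theta_iwahori [simp]: "theta h \<in> iwahori \<longleftrightarrow> h \<in> iwahori"
proof -
  have *: "absval (uniformizer * a) < 1" if "absval a \<le> 1" for a :: 'a
    using that uniformizer(2) by (rule absval_mult_less_left[rotated])
  have "theta h \<in> iwahori" if h: "h \<in> iwahori" for h :: "'a^4^4"
    using h theta_Sp4[of h]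
    by (cases h rule: mat4_cases) (simp add: theta_mat4 iwahori_mat4 * absval_div_uniformizer less_imp_le)
  from this[of h] this[of "theta h"] show ?thesis by auto
qed

lemma theta_monomial [simp]: "theta w \<in> monomial_Sp4 \<longleftrightarrow> w \<in> monomial_Sp4"
proof -
  have "theta w \<in> monomial_Sp4" if w: "w \<in> monomial_Sp4" for w :: "'a^4^4"
  proof -
    have "theta w \<in> Sp4"
      using w by simp
    with w show ?thesis
    proof (cases w rule: mat4_cases)
      case (1 a b c d e f g h i j k l m n p q)
      note rows = w[unfolded 1 monomial_mat4, THEN conjunct2]
      have 0: "uniformizer * z = 0 \<longleftrightarrow> z = 0" "z / uniformizer = 0 \<longleftrightarrow> z = 0" for z :: 'a
        by simp_all
      show ?thesis
        using \<open>theta w \<in> Sp4\<close> unfolding 1 theta_mat4 monomial_mat4 0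
        using rows[THEN conjunct1] rows[THEN conjunct2, THEN conjunct1]
          rows[THEN conjunct2, THEN conjunct2, THEN conjunct1] rows[THEN conjunct2, THEN conjunct2, THEN conjunct2]
        by (intro conjI) argo+
    qed
  qed
  from this[of w] this[of "theta w"] show ?thesis by auto
qed

text \<open>All axioms are phrased through notions that \<open>theta\<close> preserves, so the
  affine reflection inherits them from \<open>s2\<close> without another case analysis.\<close>

lemma simple_reflection_theta:
  assumes "simple_reflection s x"
  shows "simple_reflection (theta s) (\<lambda>t. theta (x t))"
proof -
  interpret simple_reflection s x by fact
  have sandwich: "theta a ** b ** spinv (theta a) \<in> iwahori \<longleftrightarrow> a ** theta b ** spinv a \<in> iwahori"
      "spinv b ** theta a ** b \<in> iwahori \<longleftrightarrow> spinv (theta b) ** a ** theta b \<in> iwahori" for a b :: "'a^4^4"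
    by (subst theta_iwahori[symmetric], simp add: theta_mult theta_spinv)+
  show ?thesis
  proof
    show "theta (x (t + u)) = theta (x t) ** theta (x u)" for t u
      by (simp add: x_add theta_mult)
    show "theta s ** theta (x t) ** spinv (theta s) \<in> iwahori \<longleftrightarrow> absval t < 1" if "absval t \<le> 1" for t
      using x_conj_iwahori[OF that] by (simp add: sandwich)
    show "theta s ** theta s \<in> iwahori"
      by (simp add: theta_mult[symmetric])
    show "\<exists>t. absval t \<le> 1 \<and> theta s ** (h ** theta (x t)) ** spinv (theta s) \<in> iwahori" if "h \<in> iwahori" for h
      using iwahori_factor[of "theta h"] that by (simp add: sandwich theta_mult)
    show "\<exists>t1 z t2. absval t1 \<le> 1 \<and> absval t2 \<le> 1 \<and> z \<in> iwahori \<inter> monomial_Sp4 \<and>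
        theta s ** theta (x t) ** spinv (theta s) = theta (x t1) ** theta s ** z ** theta (x t2)"
      if t: "absval t = 1" for t
    proof -
      obtain t1 z t2 where "absval t1 \<le> 1" "absval t2 \<le> 1" "z \<in> iwahori" "z \<in> monomial_Sp4"
        and e: "s ** x t ** spinv s = x t1 ** s ** z ** x t2"
        using x_conj_unit[OF t] by blast
      moreover have "theta s ** theta (x t) ** spinv (theta s) =
          theta (x t1) ** theta s ** theta z ** theta (x t2)"
        using arg_cong[OF e, of theta] by (simp only: theta_mult theta_spinv)
      ultimately show ?thesis
        by - (rule exI[of _ t1], rule exI[of _ "theta z"], rule exI[of _ t2], simp)
    qed
    show "(\<forall>t. absval t \<le> 1 \<longrightarrow> spinv w ** theta (x t) ** w \<in> iwahori) \<or>
        (\<forall>t. absval t \<le> 1 \<longrightarrow> spinv (theta s ** w) ** theta (x t) ** (theta s ** w) \<in> iwahori)"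
      if "w \<in> monomial_Sp4" for w
      using dichotomy[of "theta w"] that by (simp only: sandwich theta_mult theta_theta theta_monomial)
  qed simp_all
qed

text \<open>The reflection in the affine simple root 1 - 2 e_1, where 2 e_1 is the highest root;
  \<open>s0_mat4\<close> gives its matrix.\<close>

definition s0 :: "'f::nonarch_local_field_char_0^4^4" where
  "s0 = theta s2"

definition x0 :: "'f::nonarch_local_field_char_0 \<Rightarrow> 'f^4^4" where
  "x0 t = theta (x2 t)"

interpretation r0: simple_reflection "s0 :: 'f::nonarch_local_field_char_0^4^4" x0
  unfolding s0_def x0_def by (rule simple_reflection_theta) (rule r2.simple_reflection_axioms)

subsection \<open>Monomial matrices as words in the simple reflections\<close>

text \<open>Each of the eight patterns is one reflection away from an earlier one. What remains are
  arbitrary diagonal matrices, which represent the cosets of the finite Weyl group.\<close>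

lemma monomial_induct_finite [consumes 1, case_names s1 s2 torus]:
  fixes w :: "'f::nonarch_local_field_char_0^4^4"
  assumes w: "w \<in> monomial_Sp4"
    and r1: "\<And>w. w \<in> monomial_Sp4 \<Longrightarrow> Q (s1 ** w) \<Longrightarrow> Q w"
    and r2: "\<And>w. w \<in> monomial_Sp4 \<Longrightarrow> Q (s2 ** w) \<Longrightarrow> Q w"
    and t: "\<And>a b. a \<noteq> 0 \<Longrightarrow> b \<noteq> 0 \<Longrightarrow> Q (torus a b)"
  shows "Q w"
proof -
  note simps = monomial_mat4 Sp4_iff mat_one_mat4 mult.commute
  have Q1: "Q (mat4 a 0 0 0 0 b 0 0 0 0 c 0 0 0 0 d)" if "a * d = 1" "b * c = 1" for a b c d
  proof -
    have "a \<noteq> 0" "b \<noteq> 0" using that by auto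
    moreover from this have "d = inverse a" "c = inverse b"
      using that by (simp_all add: field_simps)
    ultimately show ?thesis using t unfolding torus_def by simp
  qed
  have Q2: "Q (mat4 a 0 0 0 0 0 b 0 0 c 0 0 0 0 0 d)" if "a * d = 1" "b * c = -1" for a b c d
    by (rule r2) (use that Q1[of a d c "- b"] in \<open>simp_all add: simps s2_def\<close>)
  have Q3: "Q (mat4 0 a 0 0 b 0 0 0 0 0 0 c 0 0 d 0)" if "a * d = 1" "b * c = 1" for a b c d
    by (rule r1) (use that Q1[of b c "- a" "- d"] in \<open>simp_all add: simps s1_def\<close>)
  have Q4: "Q (mat4 0 a 0 0 0 0 0 b c 0 0 0 0 0 d 0)" if "a * d = 1" "b * c = -1" for a b c d
    by (rule r2) (use that Q3[of a d c "- b"] in \<open>simp_all add: simps s2_def\<close>)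
  have Q5: "Q (mat4 0 0 a 0 b 0 0 0 0 0 0 c 0 d 0 0)" if "a * d = -1" "b * c = 1" for a b c d
    by (rule r1) (use that Q2[of b c "- a" "- d"] in \<open>simp_all add: simps s1_def\<close>)
  have Q6: "Q (mat4 0 0 a 0 0 0 0 b c 0 0 0 0 d 0 0)" if "a * d = -1" "b * c = -1" for a b c d
    by (rule r2) (use that Q5[of a d c "- b"] in \<open>simp_all add: simps s2_def\<close>)
  have Q7: "Q (mat4 0 0 0 a 0 b 0 0 0 0 c 0 d 0 0 0)" if "a * d = -1" "b * c = 1" for a b c d
    by (rule r1) (use that Q4[of b c "- a" "- d"] in \<open>simp_all add: simps s1_def\<close>)
  have Q8: "Q (mat4 0 0 0 a 0 0 b 0 0 c 0 0 d 0 0 0)" if "a * d = -1" "b * c = -1" for a b c d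
    by (rule r2) (use that Q7[of a d c "- b"] in \<open>simp_all add: simps s2_def\<close>)
  from w show ?thesis
    by (cases rule: monomial_Sp4_cases) (simp_all add: Q1 Q2 Q3 Q4 Q5 Q6 Q7 Q8)
qed

lemma s0_mat4: "s0 = mat4 0 0 0 (- inverse uniformizer) 0 1 0 0 0 0 1 0 uniformizer 0 0 0"
  by (simp add: s0_def s2_def theta_mat4 field_simps)

text \<open>Translations are words in the three reflections, so diagonal matrices reduce further to
  those with unit entries. The premises are equivalences because translations must also be
  undone.\<close>

lemma monomial_induct_affine [consumes 1, case_names s0 s1 s2 torus]:
  fixes w :: "'f::nonarch_local_field_char_0^4^4"
  assumes w: "w \<in> monomial_Sp4"
    and r0: "\<And>w. w \<in> monomial_Sp4 \<Longrightarrow> Q (s0 ** w) \<longleftrightarrow> Q w"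
    and r1: "\<And>w. w \<in> monomial_Sp4 \<Longrightarrow> Q (s1 ** w) \<longleftrightarrow> Q w"
    and r2: "\<And>w. w \<in> monomial_Sp4 \<Longrightarrow> Q (s2 ** w) \<longleftrightarrow> Q w"
    and t: "\<And>a b. absval a = 1 \<Longrightarrow> absval b = 1 \<Longrightarrow> Q (torus a b)"
  shows "Q w"
  using w
proof (induction rule: monomial_induct_finite)
  case (torus a b)
  have a: "Q (torus a b) \<longleftrightarrow> Q (torus (uniformizer * a) b)" if "a \<noteq> 0" "b \<noteq> 0" for a b :: 'f
  proof -
    have N: "torus (uniformizer * a) b \<in> monomial_Sp4"
      using that by (simp add: torus_monomial)
    \<comment> \<open>\<open>s1 ** s2 ** spinv s1\<close> is the reflection in the highest root and
      \<open>s0\<close> its affine partner, so their product is a translation. As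
      \<open>s1 ** s1\<close> is minus the identity, three factors \<open>s1\<close> stand for the
      inverse of \<open>s1\<close>.\<close>
    have "torus a b = s0 ** (s1 ** (s2 ** (s1 ** (s1 ** (s1 ** torus (uniformizer * a) b)))))"
      using that by (simp add: torus_def s0_mat4 s1_def s2_def field_simps)
    also have "Q \<dots> \<longleftrightarrow> Q (torus (uniformizer * a) b)"
      using N by (simp only: r0 r1 r2 monomial_mult r0.s_monomial r1.s_monomial r2.s_monomial)
    finally show ?thesis .
  qed
  have b: "Q (torus a b) \<longleftrightarrow> Q (torus a (uniformizer * b))" if "a \<noteq> 0" "b \<noteq> 0" for a b :: 'f
  proof -
    have N: "torus a (uniformizer * b) \<in> monomial_Sp4"
      using that by (simp add: torus_monomial)
    have "torus a b = s1 ** (s0 ** (s1 ** (s2 ** (s1 ** (s1 ** torus a (uniformizer * b))))))"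
      using that by (simp add: torus_def s0_mat4 s1_def s2_def field_simps)
    also have "Q \<dots> \<longleftrightarrow> Q (torus a (uniformizer * b))"
      using N by (simp only: r0 r1 r2 monomial_mult r0.s_monomial r1.s_monomial r2.s_monomial)
    finally show ?thesis .
  qed
  have "Q (torus a b)" if "absval a = 1" "b \<noteq> 0" for a b :: 'f
    using that(2)
  proof (rule uniformizer_induct[where Q = "\<lambda>b. Q (torus a b)", rotated 2])
    show "Q (torus a b)" if "absval b = 1" for b
      using t \<open>absval a = 1\<close> that by blast
    show "Q (torus a b) \<longleftrightarrow> Q (torus a (uniformizer * b))" if "b \<noteq> 0" for b
      using \<open>absval a = 1\<close> that by (intro b) auto
  qed
  then show ?case
    using torus(2) by (intro uniformizer_induct[where Q = "\<lambda>a. Q (torus a b)", OF _ _ torus(1)] a)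
qed (use r1 r2 in blast)+

subsection \<open>The Bruhat decomposition\<close>

definition bruhat_cells :: "('f::nonarch_local_field_char_0^4^4) set" where
  "bruhat_cells = {h ** w ** h' | h w h'. h \<in> iwahori \<and> w \<in> monomial_Sp4 \<and> h' \<in> iwahori}"

text \<open>Inverses are built in to make this a group. The decomposition follows once the group is
  shown to contain generators of \<open>Sp4\<close>.\<close>

definition bruhat_stabilizer :: "('f::nonarch_local_field_char_0^4^4) set" where
  "bruhat_stabilizer = {k \<in> Sp4. \<forall>g\<in>bruhat_cells. k ** g \<in> bruhat_cells \<and> spinv k ** g \<in> bruhat_cells}"

lemma bruhat_stabilizer_Sp4: "k \<in> bruhat_stabilizer \<Longrightarrow> k \<in> Sp4"
  by (simp add: bruhat_stabilizer_def)

lemma bruhat_stabilizer_mult: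
  "k \<in> bruhat_stabilizer \<Longrightarrow> l \<in> bruhat_stabilizer \<Longrightarrow> k ** l \<in> bruhat_stabilizer"
  by (auto simp: bruhat_stabilizer_def spinv_mult matrix_mul_assoc[symmetric])

lemma bruhat_stabilizer_spinv: "k \<in> bruhat_stabilizer \<Longrightarrow> spinv k \<in> bruhat_stabilizer"
  by (auto simp: bruhat_stabilizer_def)

lemma bruhat_stabilizer_cancel_left:
  assumes "k \<in> bruhat_stabilizer" "k ** g \<in> bruhat_stabilizer"
  shows "g \<in> bruhat_stabilizer"
proof -
  have "spinv k ** (k ** g) \<in> bruhat_stabilizer"
    using assms bruhat_stabilizer_mult bruhat_stabilizer_spinv by blast
  then show ?thesis
    using bruhat_stabilizer_Sp4[OF assms(1)] by (simp add: mat_simps)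
qed

lemma bruhat_stabilizer_cancel_right:
  assumes "k \<in> bruhat_stabilizer" "g ** k \<in> bruhat_stabilizer"
  shows "g \<in> bruhat_stabilizer"
proof -
  have "(g ** k) ** spinv k \<in> bruhat_stabilizer"
    using assms bruhat_stabilizer_mult bruhat_stabilizer_spinv by blast
  then show ?thesis
    using bruhat_stabilizer_Sp4[OF assms(1)] by (simp add: mat_simps)
qed

lemma bruhat_cells_iwahori:
  assumes "h \<in> iwahori" "g \<in> bruhat_cells" shows "h ** g \<in> bruhat_cells"
proof -
  obtain k w k' where "k \<in> iwahori" "w \<in> monomial_Sp4" "k' \<in> iwahori" "g = k ** w ** k'"
    using assms(2) by (auto simp: bruhat_cells_def)
  moreover from this have "h ** g = (h ** k) ** w ** k'"
    by (simp add: mat_simps)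
  ultimately show ?thesis
    unfolding bruhat_cells_def using assms(1) iwahori_mult by blast
qed

lemma bruhat_stabilizer_iwahori: "h \<in> iwahori \<Longrightarrow> h \<in> bruhat_stabilizer"
  by (simp add: bruhat_stabilizer_def bruhat_cells_iwahori)

lemma (in simple_reflection) bruhat_stabilizer_s: "s \<in> bruhat_stabilizer"
proof -
  have s: "s ** g \<in> bruhat_cells" if "g \<in> bruhat_cells" for g
  proof -
    obtain k w k' where k: "k \<in> iwahori" "w \<in> monomial_Sp4" "k' \<in> iwahori" "g = k ** w ** k'"
      using \<open>g \<in> bruhat_cells\<close> by (auto simp: bruhat_cells_def)
    obtain h' w' h'' where h: "h' \<in> iwahori" "w' \<in> monomial_Sp4" "h'' \<in> iwahori"
      "s ** k ** w = h' ** w' ** h''"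
      using double_coset_closed[OF k(1,2)] .
    have "s ** g = h' ** w' ** (h'' ** k')"
      unfolding k(4) using h(4) by (simp add: mat_simps)
    then show ?thesis
      unfolding bruhat_cells_def using h k iwahori_mult by blast
  qed
  moreover have "spinv s ** g \<in> bruhat_cells" if "g \<in> bruhat_cells" for g
  proof -
    have "spinv s ** g = spinv (s ** s) ** (s ** g)"
      by (simp add: mat_simps)
    then show ?thesis
      using s[OF that] by (simp add: bruhat_cells_iwahori del: spinv_mult)
  qed
  ultimately show ?thesis
    by (simp add: bruhat_stabilizer_def)
qed

lemma bruhat_stabilizer_monomial:
  assumes "w \<in> monomial_Sp4" shows "w \<in> bruhat_stabilizer"
  using assms
proof (induction rule: monomial_induct_affine)
  case (torus a b)
  then show ?case by (intro bruhat_stabilizer_iwahori torus_iwahori)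
qed (use bruhat_stabilizer_mult bruhat_stabilizer_cancel_left
      r0.bruhat_stabilizer_s r1.bruhat_stabilizer_s r2.bruhat_stabilizer_s in blast)+

section \<open>The Klingen parabolic: its unipotent radical \<open>heisenberg\<close> and the SL2 in
  its Levi factor\<close>

definition heisenberg :: "'f::field \<Rightarrow> 'f \<Rightarrow> 'f \<Rightarrow> 'f^4^4" where
  "heisenberg b c d = mat4 1 b c d 0 1 0 c 0 0 1 (- b) 0 0 0 1"

lemma ex_absval_scale:
  fixes A :: "'f::nonarch_local_field_char_0 set"
  assumes "finite A"
  shows "\<exists>l. l \<noteq> 0 \<and> absval l \<le> 1 \<and> (\<forall>a\<in>A. absval (l * a) \<le> 1)"
proof -
  define M where "M = Max (insert 1 (absval ` A))"
  have M: "1 \<le> M" "\<And>a. a \<in> A \<Longrightarrow> absval a \<le> M"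
    unfolding M_def using assms by (auto intro: Max_ge)
  obtain n where n: "absval (uniformizer :: 'f) ^ n < 1 / M"
    using real_arch_pow_inv[of "1 / M" "absval (uniformizer :: 'f)"] uniformizer(2)[where 'a='f] M by auto
  have pow: "absval ((uniformizer :: 'f) ^ n) = absval (uniformizer :: 'f) ^ n"
    by (induction n) (simp_all add: absval_mult)
  show ?thesis
  proof (intro exI[of _ "uniformizer ^ n"] conjI ballI)
    show "absval ((uniformizer :: 'f) ^ n) \<le> 1"
      unfolding pow using uniformizer(2)[where 'a='f] by (simp add: power_le_one)
    fix a assume "a \<in> A"
    then have "absval (uniformizer :: 'f) ^ n * absval a \<le> 1 / M * M"
      using n M by (intro mult_mono) auto
    then show "absval (uniformizer ^ n * a) \<le> 1"
      using M by (simp add: absval_mult pow)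
  qed simp
qed

text \<open>A torus element with a small entry contracts any given unipotent element into the
  Iwahori subgroup, and torus elements already lie in the stabilizer.\<close>

lemma bruhat_stabilizer_heisenberg: "heisenberg b c d \<in> bruhat_stabilizer"
proof -
  obtain l where l: "l \<noteq> 0" "absval l \<le> 1" "absval (l * b) \<le> 1" "absval (l * c) \<le> 1" "absval (l * d) \<le> 1"
    using ex_absval_scale[of "{b, c, d}"] by (simp, blast)
  have t: "torus l 1 \<in> bruhat_stabilizer"
    using l by (intro bruhat_stabilizer_monomial torus_monomial) auto
  have "absval (l * (l * d)) \<le> 1"
    using l(2,5) by (rule absval_mult_le)
  moreover have "heisenberg (l * b) (l * c) (l * (l * d)) \<in> Sp4"
    by (simp add: heisenberg_def Sp4_iff mat_one_mat4)
  ultimately have "heisenberg (l * b) (l * c) (l * (l * d)) \<in> iwahori"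
    using l by (simp add: heisenberg_def iwahori_mat4)
  moreover have "torus l 1 ** heisenberg b c d ** spinv (torus l 1) = heisenberg (l * b) (l * c) (l * (l * d))"
    using l by (simp add: torus_def heisenberg_def mult_ac)
  ultimately show ?thesis
    using t bruhat_stabilizer_iwahori bruhat_stabilizer_cancel_left bruhat_stabilizer_cancel_right
      bruhat_stabilizer_spinv by metis
qed

lemma bruhat_stabilizer_x2: "x2 t \<in> bruhat_stabilizer"
proof -
  obtain l where l: "l \<noteq> 0" "absval l \<le> 1" "absval (l * t) \<le> 1"
    using ex_absval_scale[of "{t}"] by (simp, blast)
  have m: "torus 1 l \<in> bruhat_stabilizer"
    using l by (intro bruhat_stabilizer_monomial torus_monomial) auto
  have "x2 (l * (l * t)) \<in> iwahori"
    using l(2,3) by (intro r2.x_iwahori absval_mult_le[of l "l * t"])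
  moreover have "torus 1 l ** x2 t ** spinv (torus 1 l) = x2 (l * (l * t))"
    using l by (simp add: torus_def x2_def mult_ac)
  ultimately show ?thesis
    using m bruhat_stabilizer_iwahori bruhat_stabilizer_cancel_left bruhat_stabilizer_cancel_right
      bruhat_stabilizer_spinv by metis
qed

text \<open>Lower triangular times diagonal times upper triangular in SL2 if the corner entry is
  nonzero; otherwise \<open>s2\<close> first makes it so.\<close>

lemma bruhat_stabilizer_Levi:
  fixes p q r s :: "'f::nonarch_local_field_char_0"
  assumes "mat4 1 0 0 0 0 p q 0 0 r s 0 0 0 0 1 \<in> Sp4"
  shows "mat4 1 0 0 0 0 p q 0 0 r s 0 0 0 0 1 \<in> bruhat_stabilizer"
proof -
  let ?g = "mat4 1 0 0 0 0 p q 0 0 r s 0 0 0 0 1"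
  have s2: "s2 \<in> bruhat_stabilizer"
    by (rule r2.bruhat_stabilizer_s)
  have *: "mat4 1 0 0 0 0 a b 0 0 c d 0 0 0 0 1 \<in> bruhat_stabilizer" if "a \<noteq> 0" "a * d - b * c = 1" for a b c d :: 'f
  proof -
    have "torus 1 a \<in> bruhat_stabilizer"
      using \<open>a \<noteq> 0\<close> by (intro bruhat_stabilizer_monomial torus_monomial) auto
    then have "s2 ** x2 (- c / a) ** spinv s2 ** torus 1 a ** x2 (b / a) \<in> bruhat_stabilizer"
      using s2 by (intro bruhat_stabilizer_mult bruhat_stabilizer_x2 bruhat_stabilizer_spinv)
    also have "s2 ** x2 (- c / a) ** spinv s2 ** torus 1 a ** x2 (b / a) = mat4 1 0 0 0 0 a b 0 0 c d 0 0 0 0 1"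
      using that by (simp add: s2_def x2_def torus_def field_simps)
    finally show ?thesis .
  qed
  have det: "p * s - q * r = 1"
    using assms by (simp add: Sp4_iff mat_one_mat4 algebra_simps)
  show ?thesis
  proof (cases "p = 0")
    case True
    then have "s2 ** ?g \<in> bruhat_stabilizer"
      using det *[of r "- q" s "- p"] by (cases "r = 0") (simp_all add: s2_def mult.commute)
    then show ?thesis
      using s2 bruhat_stabilizer_cancel_left by blast
  qed (use * det in blast)
qed

text \<open>Gaussian elimination on the first column. The numbered facts run backwards: fact 1 is
  the last stage, where the first column is already a unit vector.\<close>

lemma Sp4_eq_bruhat_stabilizer:
  assumes "g \<in> Sp4" shows "g \<in> bruhat_stabilizer"
proof -
  have 1: "g \<in> bruhat_stabilizer"
    if "g \<in> Sp4" "g$1$1 = 1" "g$2$1 = 0" "g$3$1 = 0" "g$4$1 = 0" for g :: "'a^4^4"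
  proof (cases g rule: mat4_cases)
    case (1 a b c d e f g' h i j k l m n p q)
    then have z: "a = 1" "e = 0" "i = 0" "m = 0" using that by simp_all
    have "spinv g ** g = mat 1"
      using that by simp
    \<comment> \<open>A symplectic matrix that fixes the first basis vector has a forced last
      row.\<close>
    then have r: "n = 0" "p = 0" "q = 1"
      unfolding 1 z by (simp_all add: mat_one_mat4)
    define u where "u = g ** heisenberg (- b) (- c) (- d)"
    have U: "heisenberg (- b) (- c) (- d) \<in> bruhat_stabilizer"
      by (rule bruhat_stabilizer_heisenberg)
    then have uS: "u \<in> Sp4"
      unfolding u_def using that bruhat_stabilizer_Sp4 by blast
    define h' l' where "h' = h + g' * b - f * c" and "l' = l + k * b - j * c"
    have u: "u = mat4 1 0 0 0 0 f g' h' 0 j k l' 0 0 0 1"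
      unfolding u_def 1 z r heisenberg_def h'_def l'_def by (simp add: algebra_simps)
    have "u ** spinv u = mat 1"
      using uS by simp
    then have "h' = 0" "l' = 0"
      unfolding u by (simp_all add: mat_one_mat4)
    with uS have "u \<in> bruhat_stabilizer"
      unfolding u by (simp add: bruhat_stabilizer_Levi)
    then show ?thesis
      using U bruhat_stabilizer_cancel_right unfolding u_def by blast
  qed
  have 2: "g \<in> bruhat_stabilizer" if "g \<in> Sp4" "g$1$1 = 1" for g :: "'a^4^4"
  proof -
    \<comment> \<open>The longest Weyl group element conjugates \<open>heisenberg\<close> to the
      opposite unipotent radical, which clears the first column.\<close>
    define L where "L = spinv s1 ** spinv s2 ** spinv s1 ** spinv s2 ** heisenberg (g$2$1) (g$3$1) (g$4$1) ** s2 ** s1 ** s2 ** s1"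
    have LK: "L \<in> bruhat_stabilizer"
      unfolding L_def
      by (intro bruhat_stabilizer_mult bruhat_stabilizer_spinv bruhat_stabilizer_heisenberg
          r1.bruhat_stabilizer_s r2.bruhat_stabilizer_s)
    have L: "L = mat4 1 0 0 0 (- g$2$1) 1 0 0 (- g$3$1) 0 1 0 (- g$4$1) (- g$3$1) (g$2$1) 1"
      unfolding L_def by (simp add: s1_def s2_def heisenberg_def)
    have "L ** g \<in> Sp4"
      using LK that bruhat_stabilizer_Sp4 by blast
    moreover have "(L ** g)$1$1 = 1" "(L ** g)$2$1 = 0" "(L ** g)$3$1 = 0" "(L ** g)$4$1 = 0"
      unfolding L using that(2) by (cases g rule: mat4_cases, simp add: mult.commute)+
    ultimately have "L ** g \<in> bruhat_stabilizer"
      by (rule 1)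
    then show ?thesis
      using LK bruhat_stabilizer_cancel_left by blast
  qed
  have 3: "g \<in> bruhat_stabilizer" if "g \<in> Sp4" "g$1$1 \<noteq> 0" for g :: "'a^4^4"
  proof -
    have t: "torus (inverse (g$1$1)) 1 \<in> bruhat_stabilizer"
      using that by (intro bruhat_stabilizer_monomial torus_monomial) auto
    have "(torus (inverse (g$1$1)) 1 ** g)$1$1 = 1"
      using that(2) by (cases g rule: mat4_cases) (simp add: torus_def)
    then have "torus (inverse (g$1$1)) 1 ** g \<in> bruhat_stabilizer"
      using t that bruhat_stabilizer_Sp4 by (intro 2) auto
    then show ?thesis
      using t bruhat_stabilizer_cancel_left by blast
  qed
  have 4: "g \<in> bruhat_stabilizer" if "g \<in> Sp4" "k \<in> bruhat_stabilizer" "(k ** g)$1$1 \<noteq> 0" for g k :: "'a^4^4"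
    using 3[of "k ** g"] that bruhat_stabilizer_cancel_left bruhat_stabilizer_Sp4 by blast
  note K = bruhat_stabilizer_mult r1.bruhat_stabilizer_s r2.bruhat_stabilizer_s
  have "g$1$1 \<noteq> 0 \<or> g$2$1 \<noteq> 0 \<or> g$3$1 \<noteq> 0 \<or> g$4$1 \<noteq> 0"
  proof (rule ccontr)
    assume "\<not> ?thesis"
    then have "(spinv g ** g)$1$1 = 0"
      by (cases g rule: mat4_cases) simp
    then show False
      using assms by (simp add: mat_one_mat4)
  qed
  moreover have "(s1 ** g)$1$1 = g$2$1" "(s1 ** s2 ** g)$1$1 = g$3$1" "(s1 ** s2 ** s1 ** g)$1$1 = - g$4$1"
    by (cases g rule: mat4_cases, simp add: s1_def s2_def)+
  ultimately show ?thesis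
    using 3[OF assms] 4[OF assms, of s1] 4[OF assms, of "s1 ** s2"] 4[OF assms, of "s1 ** s2 ** s1"] K
    by (metis neg_equal_0_iff_equal)
qed

lemma bruhat_decomposition:
  assumes "g \<in> Sp4"
  obtains h w h' where "h \<in> iwahori" "w \<in> monomial_Sp4" "h' \<in> iwahori" "g = h ** w ** h'"
proof -
  have "torus 1 1 \<in> (monomial_Sp4 :: ('a^4^4) set)"
    by (rule torus_monomial) simp_all
  then have "mat 1 \<in> (monomial_Sp4 :: ('a^4^4) set)"
    by (simp add: torus_def mat_one_mat4)
  then have "mat 1 ** mat 1 ** mat 1 \<in> (bruhat_cells :: ('a^4^4) set)"
    unfolding bruhat_cells_def using iwahori_mat_1 by blast
  then have "mat 1 \<in> (bruhat_cells :: ('a^4^4) set)"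
    by (simp add: mat_simps)
  then have "g ** mat 1 \<in> bruhat_cells"
    using Sp4_eq_bruhat_stabilizer[OF assms] unfolding bruhat_stabilizer_def by blast
  then show thesis
    using that by (auto simp: bruhat_cells_def mat_simps)
qed

subsection \<open>Hecke operators\<close>

text \<open>The matrices \<open>x t ** s\<close> represent the cosets of the Iwahori subgroup in the
  double coset of \<open>s\<close>, so this is its unnormalized operator; independence of the
  representatives holds on Iwahori-fixed vectors.\<close>

definition hecke_op :: "('f::nonarch_local_field_char_0^4^4 \<Rightarrow> 'w::ab_group_add \<Rightarrow> 'w) \<Rightarrow> 'f^4^4 \<Rightarrow> ('f \<Rightarrow> 'f^4^4) \<Rightarrow> 'w \<Rightarrow> 'w" where
  "hecke_op \<pi> s x v = (\<Sum>t\<in>residue_reps. \<pi> (x t ** s) v)"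

text \<open>The form may be degenerate here, so that the locale applies to a form as well as to its
  skew part.\<close>

locale representation_with_form =
  fixes smul :: "complex \<Rightarrow> 'w::ab_group_add \<Rightarrow> 'w"
    and \<pi> :: "'f::nonarch_local_field_char_0^4^4 \<Rightarrow> 'w \<Rightarrow> 'w"
    and B :: "'w \<Rightarrow> 'w \<Rightarrow> complex"
    and q :: complex
  assumes q_def: "q = of_nat (card (residue_reps :: 'f set))"
    and representation: "Sp4_representation smul \<pi>"
    and invariant: "invariant_form smul \<pi> B"
begin

sublocale vs: vector_space smul
  using representation by (simp add: Sp4_representation_def)

definition W :: "'w set" where
  "W = fixed_vectors \<pi> iwahori"

lemma q_nonzero [simp]: "q \<noteq> 0"
  using card_residue_reps_pos[where 'a='f] unfolding q_def of_nat_eq_0_iff by linarith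

lemma q_plus_one_nonzero [simp]: "q + 1 \<noteq> 0" "1 + q \<noteq> 0"
proof -
  have "of_nat (Suc (card (residue_reps :: 'f set))) \<noteq> (0::complex)"
    by (simp only: of_nat_neq_0 not_False_eq_True)
  then show "q + 1 \<noteq> 0" "1 + q \<noteq> 0"
    by (simp_all add: q_def add.commute)
qed

lemma linear_\<pi>: "g \<in> Sp4 \<Longrightarrow> Vector_Spaces.linear smul smul (\<pi> g)"
  using representation by (simp add: Sp4_representation_def)

lemma \<pi>_add: "g \<in> Sp4 \<Longrightarrow> \<pi> g (v + w) = \<pi> g v + \<pi> g w"
  by (rule module_hom.add[OF Vector_Spaces.linear.axioms(3)[OF linear_\<pi>]])

lemma \<pi>_smul: "g \<in> Sp4 \<Longrightarrow> \<pi> g (smul c v) = smul c (\<pi> g v)"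
  by (rule module_hom.scale[OF Vector_Spaces.linear.axioms(3)[OF linear_\<pi>]])

lemma \<pi>_sum: "g \<in> Sp4 \<Longrightarrow> \<pi> g (\<Sum>i\<in>A. f i) = (\<Sum>i\<in>A. \<pi> g (f i))"
  by (rule module_hom.sum[OF Vector_Spaces.linear.axioms(3)[OF linear_\<pi>]])

lemma \<pi>_one [simp]: "\<pi> (mat 1) v = v"
  using representation by (simp add: Sp4_representation_def)

lemma \<pi>_mult: "g \<in> Sp4 \<Longrightarrow> h \<in> Sp4 \<Longrightarrow> \<pi> (g ** h) v = \<pi> g (\<pi> h v)"
  using representation by (simp add: Sp4_representation_def)

lemma B_linear: "Vector_Spaces.linear smul (*) (\<lambda>w. B v w)" "Vector_Spaces.linear smul (*) (\<lambda>v. B v w)"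
  using invariant by (simp_all add: invariant_form_def)

lemma B_add: "B v (w + w') = B v w + B v w'" "B (v + v') w = B v w + B v' w"
  using module_hom.add[OF B_linear(1)[THEN Vector_Spaces.linear.axioms(3)]]
    module_hom.add[OF B_linear(2)[THEN Vector_Spaces.linear.axioms(3)]] by auto

lemma B_smul: "B v (smul c w) = c * B v w" "B (smul c v) w = c * B v w"
  using module_hom.scale[OF B_linear(1)[THEN Vector_Spaces.linear.axioms(3)]]
    module_hom.scale[OF B_linear(2)[THEN Vector_Spaces.linear.axioms(3)]] by auto

lemma B_sum: "B v (\<Sum>i\<in>A. f i) = (\<Sum>i\<in>A. B v (f i))" "B (\<Sum>i\<in>A. f i) w = (\<Sum>i\<in>A. B (f i) w)"
  using module_hom.sum[OF B_linear(1)[THEN Vector_Spaces.linear.axioms(3)]]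
    module_hom.sum[OF B_linear(2)[THEN Vector_Spaces.linear.axioms(3)]] by auto

lemma B_zero [simp]: "B v 0 = 0" "B 0 v = 0"
  using B_add(1)[of v 0 0] B_add(2)[of 0 0 v] by simp_all

lemma B_invariant: "g \<in> Sp4 \<Longrightarrow> B (\<pi> g v) (\<pi> g w) = B v w"
  using invariant by (simp add: invariant_form_def)

lemma B_adjoint: "g \<in> Sp4 \<Longrightarrow> B (\<pi> g v) w = B v (\<pi> (spinv g) w)"
  using B_invariant[of "spinv g" "\<pi> g v" w] by (simp add: \<pi>_mult[symmetric])

lemma W_fixed: "v \<in> W \<Longrightarrow> h \<in> iwahori \<Longrightarrow> \<pi> h v = v"
  by (simp add: W_def fixed_vectors_def)

lemma W_add [simp, intro]: "v \<in> W \<Longrightarrow> w \<in> W \<Longrightarrow> v + w \<in> W"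
  by (simp add: W_def fixed_vectors_def \<pi>_add)

lemma W_smul [simp, intro]: "v \<in> W \<Longrightarrow> smul c v \<in> W"
  by (simp add: W_def fixed_vectors_def \<pi>_smul)

lemma W_uminus [simp, intro]: "v \<in> W \<Longrightarrow> - v \<in> W"
  using W_smul[of v "-1"] by simp

lemma W_diff [simp, intro]: "v \<in> W \<Longrightarrow> w \<in> W \<Longrightarrow> v - w \<in> W"
  using W_add[of v "- w"] by simp

lemma \<pi>_mult_fixed: "g \<in> Sp4 \<Longrightarrow> h \<in> iwahori \<Longrightarrow> v \<in> W \<Longrightarrow> \<pi> (g ** h) v = \<pi> g v"
  by (simp add: \<pi>_mult W_fixed)

lemma B_iwahori_left: "g \<in> Sp4 \<Longrightarrow> h \<in> iwahori \<Longrightarrow> y \<in> W \<Longrightarrow> B (\<pi> (h ** g) v) y = B (\<pi> g v) y"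
  by (simp add: \<pi>_mult B_adjoint[of h] W_fixed)

end

locale hecke_operator = representation_with_form smul \<pi> B q + simple_reflection s x
  for smul :: "complex \<Rightarrow> 'w::ab_group_add \<Rightarrow> 'w"
    and \<pi> :: "'f::nonarch_local_field_char_0^4^4 \<Rightarrow> 'w \<Rightarrow> 'w"
    and B :: "'w \<Rightarrow> 'w \<Rightarrow> complex" and q and s :: "'f^4^4" and x
begin

abbreviation T :: "'w \<Rightarrow> 'w" where
  "T \<equiv> hecke_op \<pi> s x"

lemma T_add: "T (v + w) = T v + T w"
  by (simp add: hecke_op_def \<pi>_add sum.distrib)

lemma T_smul: "T (smul c v) = smul c (T v)"
  by (simp add: hecke_op_def \<pi>_smul vs.scale_sum_right)

lemma T_diff: "T (v - w) = T v - T w"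
  using T_add[of "v - w" w] by simp

lemma T_summand_periodic:
  assumes "v \<in> W" "absval (t - u) < 1"
  shows "\<pi> (x t ** s) v = \<pi> (x u ** s) v"
proof -
  have "x t = x u ** x (t - u)"
    by (simp add: x_add[symmetric])
  then have "x t ** s = (x u ** s) ** (spinv s ** x (t - u) ** s)"
    by (simp add: mat_simps)
  moreover have "spinv s ** x (t - u) ** s \<in> iwahori"
    using assms(2) by (simp add: conj_iwahori_swap x_conj_iwahori)
  ultimately show ?thesis
    using assms(1) \<pi>_mult_fixed by simp
qed

text \<open>An Iwahori element \<open>h\<close> permutes the cosets of the \<open>x t ** s\<close>;
  \<open>f\<close> describes the induced map of residue classes.\<close>

lemma T_W [simp, intro]:
  assumes v: "v \<in> W" shows "T v \<in> W"
proof -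
  have "\<pi> h (T v) = T v" if h: "h \<in> iwahori" for h
  proof -
    \<comment> \<open>\<open>iwahori_factor\<close> is applied to the inverse of
      \<open>h ** x t\<close>; inverting its conclusion yields the index \<open>u\<close> of the
      image coset.\<close>
    have ex: "\<exists>u. absval u \<le> 1 \<and> s ** (spinv (x u) ** h ** x t) ** spinv s \<in> iwahori" if t: "absval t \<le> 1" for t
    proof -
      have "spinv (h ** x t) \<in> iwahori"
        using h t by (intro iwahori_spinv iwahori_mult x_iwahori)
      then obtain u where u: "absval u \<le> 1" "s ** (spinv (h ** x t) ** x u) ** spinv s \<in> iwahori"
        using iwahori_factor by blast
      have "spinv (s ** (spinv (h ** x t) ** x u) ** spinv s) \<in> iwahori"
        using u(2) by blast
      also have "spinv (s ** (spinv (h ** x t) ** x u) ** spinv s) = s ** (spinv (x u) ** h ** x t) ** spinv s"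
        by (simp add: mat_simps)
      finally show ?thesis
        using u(1) by blast
    qed
    then obtain f where f: "\<And>t. absval t \<le> 1 \<Longrightarrow> absval (f t) \<le> 1"
        "\<And>t. absval t \<le> 1 \<Longrightarrow> s ** (spinv (x (f t)) ** h ** x t) ** spinv s \<in> iwahori"
      by metis
    have "\<pi> h (\<pi> (x t ** s) v) = \<pi> (x (f t) ** s) v" if t: "absval t \<le> 1" for t
    proof -
      have "h ** (x t ** s) = (x (f t) ** s) ** (spinv s ** (spinv (x (f t)) ** h ** x t) ** s)"
        by (simp add: mat_simps)
      moreover have "spinv s ** (spinv (x (f t)) ** h ** x t) ** s \<in> iwahori"
        using h f(2)[OF t] by (subst conj_iwahori_swap) auto
      ultimately have "\<pi> (h ** (x t ** s)) v = \<pi> (x (f t) ** s) v"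
        using v \<pi>_mult_fixed by simp
      then show ?thesis
        using h by (simp add: \<pi>_mult)
    qed
    then have "\<pi> h (T v) = (\<Sum>t\<in>residue_reps. \<pi> (x (f t) ** s) v)"
      unfolding hecke_op_def using h by (simp add: \<pi>_sum absval_residue_rep)
    also have "\<dots> = T v"
      unfolding hecke_op_def
    proof (rule sum_residue_reps_reindex[where f = f and F = "\<lambda>t. \<pi> (x t ** s) v"])
      \<comment> \<open>If two images are congruent, the conjugate of \<open>x (t - u)\<close> by
        \<open>s\<close> is a product of three Iwahori elements.\<close>
      show "absval (t - u) < 1" if "absval t \<le> 1" "absval u \<le> 1" "absval (f t - f u) < 1" for t u
      proof -
        have "s ** x (- (f u) + f t) ** spinv s \<in> iwahori"
          using that x_conj_iwahori[of "- (f u) + f t"] by (simp add: less_imp_le)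
        then have "spinv (s ** (spinv (x (f u)) ** h ** x u) ** spinv s) **
            (s ** x (- (f u) + f t) ** spinv s) ** (s ** (spinv (x (f t)) ** h ** x t) ** spinv s) \<in> iwahori"
          using iwahori_mult[OF iwahori_mult[OF iwahori_spinv[OF f(2)]] f(2)] that by blast
        also have "spinv (s ** (spinv (x (f u)) ** h ** x u) ** spinv s) **
            (s ** x (- (f u) + f t) ** spinv s) ** (s ** (spinv (x (f t)) ** h ** x t) ** spinv s)
          = s ** (spinv (x u) ** x t) ** spinv s"
          unfolding x_add spinv_x[symmetric] using h by (simp add: mat_simps)
        also have "spinv (x u) ** x t = x (t - u)"
          by (simp add: spinv_x x_add[symmetric])
        finally show ?thesis
          using x_conj_iwahori[of "t - u"] that absval_diff_le by blast
      qed
    qed (use f(1) T_summand_periodic[OF v] in blast)+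
    finally show ?thesis .
  qed
  then show ?thesis
    by (simp add: W_def fixed_vectors_def)
qed

text \<open>This is (T - q)(T + 1) = 0. In the double sum the residue class of zero contributes
  \<open>smul q v\<close>, since there \<open>s ** x r ** s\<close> is an Iwahori element; each of
  the other \<open>q - 1\<close> classes contributes \<open>T v\<close> by the rank-one
  identity.\<close>

lemma T_quadratic:
  assumes v: "v \<in> W" shows "T (T v) = smul (q - 1) (T v) + smul q v"
proof -
  \<comment> \<open>The representative of the class of zero, which need not be 0 itself.\<close>
  obtain r :: 'f where r: "r \<in> residue_reps" "absval r < 1" and r_unique: "\<And>r'. r' \<in> residue_reps \<Longrightarrow> absval r' < 1 \<Longrightarrow> r' = r"
    using ex1_residue_rep[of 0] by auto
  define G where "G u = (\<Sum>t\<in>residue_reps. \<pi> (x t) (\<pi> (s ** x u ** s) v))" for u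
  have "T (T v) = (\<Sum>t\<in>residue_reps. \<Sum>u\<in>residue_reps. \<pi> (x t) (\<pi> (s ** x u ** s) v))"
    unfolding hecke_op_def by (simp add: \<pi>_sum \<pi>_mult)
  also have "\<dots> = (\<Sum>u\<in>residue_reps. G u)"
    unfolding G_def by (rule sum.swap)
  also have "\<dots> = G r + (\<Sum>u\<in>residue_reps - {r}. G u)"
    using r by (simp add: sum.remove)
  also have "G r = smul q v"
  proof -
    have "s ** x r ** s = (s ** x r ** spinv s) ** (s ** s)"
      by (simp add: mat_simps del: s_square)
    moreover have "s ** x r ** spinv s \<in> iwahori"
      using r x_conj_iwahori by simp
    ultimately have "\<pi> (s ** x r ** s) v = v"
      using v W_fixed iwahori_mult s_square by metis
    then show ?thesis
      unfolding G_def using v by (simp add: W_fixed absval_residue_rep vs.sum_constant_scale q_def)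
  qed
  also have "(\<Sum>u\<in>residue_reps - {r}. G u) = (\<Sum>u\<in>residue_reps - {r}. T v)"
  proof (rule sum.cong)
    fix u assume u: "u \<in> residue_reps - {r}"
    then have "absval u = 1"
      using r_unique[of u] absval_residue_rep[of u] by force
    then obtain t1 z t2 where t: "absval t1 \<le> 1" "absval t2 \<le> 1" "z \<in> iwahori"
      and e: "s ** x u ** spinv s = x t1 ** s ** z ** x t2"
      using x_conj_unit by blast
    have "s ** x u ** s = (s ** x u ** spinv s) ** (s ** s)"
      by (simp add: mat_simps)
    also have "\<dots> = (x t1 ** s) ** (z ** x t2 ** (s ** s))"
      unfolding e by (simp add: mat_simps)
    finally have *: "\<pi> (s ** x u ** s) v = \<pi> (x t1 ** s) v"
      using v t \<pi>_mult_fixed by simp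
    have "G u = (\<Sum>t\<in>residue_reps. \<pi> (x (t + t1) ** s) v)"
      unfolding G_def * by (simp add: \<pi>_mult x_add)
    also have "\<dots> = T v"
      unfolding hecke_op_def
      by (rule sum_residue_reps_shift[where F = "\<lambda>t. \<pi> (x t ** s) v"]) (use T_summand_periodic[OF v] t in auto)
    finally show "G u = T v" .
  qed simp
  also have "\<dots> = smul (q - 1) (T v)"
    using r card_residue_reps_pos[where 'a='f]
    by (simp add: vs.sum_constant_scale q_def of_nat_diff card_gt_0_iff Suc_leI)
  finally show ?thesis
    by (simp add: add.commute)
qed

text \<open>By the hypothesis on \<open>w\<close> each \<open>x t\<close>, moved to the first slot,
  is absorbed by \<open>\<pi> w v\<close>, so all \<open>q\<close> summands agree.\<close>

lemma B_T_right:
  assumes w: "w \<in> Sp4" "\<forall>t. absval t \<le> 1 \<longrightarrow> spinv w ** x t ** w \<in> iwahori"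
    and v: "v \<in> W" "y \<in> W"
  shows "B (\<pi> w v) (T y) = q * B (\<pi> (s ** w) v) y"
proof -
  have "B (\<pi> w v) (\<pi> (x t ** s) y) = B (\<pi> (s ** w) v) y" if t: "t \<in> residue_reps" for t
  proof -
    have k: "spinv w ** x (- t) ** w \<in> iwahori"
      using w(2) absval_residue_rep[OF t] by simp
    have "B (\<pi> w v) (\<pi> (x t ** s) y) = B (\<pi> (spinv (x t)) (\<pi> w v)) (\<pi> s y)"
      by (simp add: \<pi>_mult B_adjoint)
    also have "\<pi> (spinv (x t)) (\<pi> w v) = \<pi> (w ** (spinv w ** x (- t) ** w)) v"
      using w(1) by (simp add: \<pi>_mult[symmetric] spinv_x mat_simps)
    also have "\<dots> = \<pi> w v"
      using k v(1) w(1) \<pi>_mult_fixed by blast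
    also have "B (\<pi> w v) (\<pi> s y) = B (\<pi> s (\<pi> w v)) (\<pi> s (\<pi> s y))"
      by (simp add: B_invariant)
    also have "\<pi> s (\<pi> s y) = y"
      using v(2) by (simp add: \<pi>_mult[symmetric] W_fixed)
    finally show ?thesis
      using w(1) by (simp add: \<pi>_mult)
  qed
  then show ?thesis
    by (simp add: hecke_op_def B_sum q_def)
qed

lemma B_T_selfadjoint:
  assumes "v \<in> W" "y \<in> W" shows "B (T v) y = B v (T y)"
proof -
  have right: "B v (T y) = q * B (\<pi> s v) y"
    using B_T_right[of "mat 1" v y] assms by (simp add: mat_simps)
  have "B (\<pi> (x t ** s) v) y = B (\<pi> s v) y" if "t \<in> residue_reps" for t
    using B_iwahori_left[of s "x t" y v] assms absval_residue_rep[OF that] by simp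
  then have "B (T v) y = q * B (\<pi> s v) y"
    by (simp add: hecke_op_def B_sum q_def)
  with right show ?thesis by simp
qed

text \<open>Stands in for comparing the lengths of \<open>w\<close> and \<open>s ** w\<close>. In
  the second case \<open>s ** s\<close> is absorbed by \<open>y\<close>.\<close>

lemma B_T_dichotomy:
  assumes w: "w \<in> monomial_Sp4"
  obtains "\<And>v y. v \<in> W \<Longrightarrow> y \<in> W \<Longrightarrow> B (\<pi> w v) (T y) = q * B (\<pi> (s ** w) v) y"
  | "\<And>v y. v \<in> W \<Longrightarrow> y \<in> W \<Longrightarrow> B (\<pi> (s ** w) v) (T y) = q * B (\<pi> w v) y"
  using dichotomy[OF w]
proof
  assume "\<forall>t. absval t \<le> 1 \<longrightarrow> spinv w ** x t ** w \<in> iwahori"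
  then show thesis
    using B_T_right w that(1) by blast
next
  assume *: "\<forall>t. absval t \<le> 1 \<longrightarrow> spinv (s ** w) ** x t ** (s ** w) \<in> iwahori"
  have "B (\<pi> (s ** w) v) (T y) = q * B (\<pi> w v) y" if "v \<in> W" "y \<in> W" for v y
  proof -
    have "B (\<pi> (s ** w) v) (T y) = q * B (\<pi> (s ** (s ** w)) v) y"
      using B_T_right[OF _ * that] w by simp
    also have "s ** (s ** w) = (s ** s) ** w"
      by (simp add: matrix_mul_assoc)
    finally show ?thesis
      using B_iwahori_left w that by simp
  qed
  then show thesis
    by (rule that(2))
qed

end

subsection \<open>The Iwahori-Hecke algebra relations\<close>

context representation_with_form
begin

sublocale h0: hecke_operator smul \<pi> B q s0 x0
  by (intro hecke_operator.intro representation_with_form_axioms r0.simple_reflection_axioms)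

sublocale h1: hecke_operator smul \<pi> B q s1 x1
  by (intro hecke_operator.intro representation_with_form_axioms r1.simple_reflection_axioms)

sublocale h2: hecke_operator smul \<pi> B q s2 x2
  by (intro hecke_operator.intro representation_with_form_axioms r2.simple_reflection_axioms)

abbreviation T0 :: "'w \<Rightarrow> 'w" where "T0 \<equiv> hecke_op \<pi> s0 x0"
abbreviation T1 :: "'w \<Rightarrow> 'w" where "T1 \<equiv> hecke_op \<pi> s1 x1"
abbreviation T2 :: "'w \<Rightarrow> 'w" where "T2 \<equiv> hecke_op \<pi> s2 x2"

text \<open>One reflection and its root group involve coordinates 1 and 4 only, the other 2 and 3,
  so the summands commute already as matrices.\<close>

lemma T0_T2_commute: "T0 (T2 v) = T2 (T0 v)"
proof -
  have "x0 t ** s0 ** (x2 u ** s2) = x2 u ** s2 ** (x0 t ** s0)" for t u :: 'f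
    by (simp add: x0_def s0_mat4 x2_def s2_def theta_mat4)
  then have "\<pi> (x0 t ** s0) (\<pi> (x2 u ** s2) v) = \<pi> (x2 u ** s2) (\<pi> (x0 t ** s0) v)" for t u
    by (simp add: \<pi>_mult[symmetric])
  then have "T0 (T2 v) = (\<Sum>t\<in>residue_reps. \<Sum>u\<in>residue_reps. \<pi> (x2 u ** s2) (\<pi> (x0 t ** s0) v))"
    by (simp add: hecke_op_def \<pi>_sum)
  also have "\<dots> = T2 (T0 v)"
    by (subst sum.swap) (simp add: hecke_op_def \<pi>_sum)
  finally show ?thesis .
qed

text \<open>Both words enumerate the cosets in the double coset of the longest Weyl group element.
  \<open>L_R\<close> compares the parameters, and periodicity modulo the maximal ideal turns this
  into a reindexing.\<close>

lemma T1_T2_braid: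
  assumes v: "v \<in> W" shows "T1 (T2 (T1 (T2 v))) = T2 (T1 (T2 (T1 v)))"
proof -
  define L where "L a b c d = x1 a ** s1 ** (x2 b ** s2) ** (x1 c ** s1) ** (x2 d ** s2)" for a b c d :: 'f
  define R where "R d c b a = x2 d ** s2 ** (x1 c ** s1) ** (x2 b ** s2) ** (x1 a ** s1)" for a b c d :: 'f
  have R: "R d c b a \<in> Sp4" for a b c d
    by (simp add: R_def)
  have L_R: "L a b c d = R d (- (a * d) - c) (b + (a * c + a * c + a * a * d)) a" for a b c d
    by (simp add: L_def R_def x1_def x2_def s1_def s2_def algebra_simps)
  have b_periodic: "\<pi> (R d c b a) v = \<pi> (R d c b' a) v" if "absval (b - b') < 1" for a b c d b'
  proof -
    define k where "k = mat4 1 0 0 0 0 1 0 0 0 0 1 0 (- (b - b')) 0 0 1"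
    have "k \<in> iwahori"
      unfolding k_def using that absval_minus_commute[of b b'] by (simp add: iwahori_mat4 Sp4_iff mat_one_mat4)
    moreover have "R d c b a = R d c b' a ** k"
      by (simp add: k_def R_def x1_def x2_def s1_def s2_def algebra_simps)
    ultimately show ?thesis
      using v R \<pi>_mult_fixed by simp
  qed
  have c_periodic: "\<pi> (R d c b a) v = \<pi> (R d c' b a) v" if "absval (c - c') < 1" "absval a \<le> 1" for a b c d c'
  proof -
    define k where "k = mat4 1 0 0 0 0 1 0 0 (c - c') 0 1 0 (- (a * (c - c')) - a * (c - c')) (c - c') 0 1"
    have "k \<in> iwahori"
      unfolding k_def using that absval_diff_less[of "- (a * (c - c'))" 1 "a * (c - c')"] absval_mult_less_right[of a "c - c'"]
      by (simp add: iwahori_mat4 Sp4_iff mat_one_mat4)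
    moreover have "R d c b a = R d c' b a ** k"
      by (simp add: k_def R_def x1_def x2_def s1_def s2_def algebra_simps)
    ultimately show ?thesis
      using v R \<pi>_mult_fixed by simp
  qed
  let ?S = "residue_reps :: 'f set"
  have "T1 (T2 (T1 (T2 v))) = (\<Sum>a\<in>?S. \<Sum>b\<in>?S. \<Sum>c\<in>?S. \<Sum>d\<in>?S. \<pi> (L a b c d) v)"
    by (simp add: hecke_op_def \<pi>_sum \<pi>_mult L_def)
  \<comment> \<open>In \<open>L_R\<close> the shift of \<open>b\<close> depends on \<open>a\<close>,
    \<open>c\<close>, \<open>d\<close>, and the reflection of \<open>c\<close> on \<open>a\<close>,
    \<open>d\<close>; hence \<open>b\<close> is summed innermost and \<open>c\<close> next.\<close>
  also have "\<dots> = (\<Sum>a\<in>?S. \<Sum>d\<in>?S. \<Sum>c\<in>?S. \<Sum>b\<in>?S. \<pi> (L a b c d) v)"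
  proof (rule sum.cong[OF refl])
    fix a
    have "(\<Sum>b\<in>?S. \<Sum>c\<in>?S. \<Sum>d\<in>?S. \<pi> (L a b c d) v) = (\<Sum>b\<in>?S. \<Sum>d\<in>?S. \<Sum>c\<in>?S. \<pi> (L a b c d) v)"
      by (intro sum.cong refl sum.swap)
    also have "\<dots> = (\<Sum>d\<in>?S. \<Sum>b\<in>?S. \<Sum>c\<in>?S. \<pi> (L a b c d) v)"
      by (rule sum.swap)
    also have "\<dots> = (\<Sum>d\<in>?S. \<Sum>c\<in>?S. \<Sum>b\<in>?S. \<pi> (L a b c d) v)"
      by (intro sum.cong refl sum.swap)
    finally show "(\<Sum>b\<in>?S. \<Sum>c\<in>?S. \<Sum>d\<in>?S. \<pi> (L a b c d) v) = \<dots>" .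
  qed
  also have "\<dots> = (\<Sum>a\<in>?S. \<Sum>d\<in>?S. \<Sum>c\<in>?S. \<Sum>b\<in>?S. \<pi> (R d c b a) v)"
  proof (rule sum.cong[OF refl], rule sum.cong[OF refl])
    fix a d assume "a \<in> ?S" "d \<in> ?S"
    then have a: "absval a \<le> 1" and d: "absval d \<le> 1"
      by (simp_all add: absval_residue_rep)
    have "(\<Sum>b\<in>?S. \<pi> (L a b c d) v) = (\<Sum>b\<in>?S. \<pi> (R d (- (a * d) - c) b a) v)" if "c \<in> ?S" for c
      unfolding L_R
    proof (rule sum_residue_reps_shift[where F = "\<lambda>b. \<pi> (R d (- (a * d) - c) b a) v"])
      show "absval (a * c + a * c + a * a * d) \<le> 1"
        using a d absval_residue_rep[OF that] by (intro absval_add_le absval_mult_le)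
    qed (use b_periodic in blast)
    then have "(\<Sum>c\<in>?S. \<Sum>b\<in>?S. \<pi> (L a b c d) v) = (\<Sum>c\<in>?S. \<Sum>b\<in>?S. \<pi> (R d (- (a * d) - c) b a) v)"
      by (rule sum.cong[OF refl])
    also have "\<dots> = (\<Sum>c\<in>?S. \<Sum>b\<in>?S. \<pi> (R d c b a) v)"
    proof (rule sum_residue_reps_reflect[where F = "\<lambda>c. \<Sum>b\<in>?S. \<pi> (R d c b a) v"])
      show "absval (- (a * d)) \<le> 1"
        using a d by (simp add: absval_mult_le)
      show "(\<Sum>b\<in>?S. \<pi> (R d t b a) v) = (\<Sum>b\<in>?S. \<pi> (R d u b a) v)" if "absval (t - u) < 1" for t u
        using c_periodic[OF that a] by simp
    qed
    finally show "(\<Sum>c\<in>?S. \<Sum>b\<in>?S. \<pi> (L a b c d) v) = (\<Sum>c\<in>?S. \<Sum>b\<in>?S. \<pi> (R d c b a) v)" .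
  qed
  also have "\<dots> = (\<Sum>d\<in>?S. \<Sum>c\<in>?S. \<Sum>b\<in>?S. \<Sum>a\<in>?S. \<pi> (R d c b a) v)"
  proof -
    have "(\<Sum>a\<in>?S. \<Sum>d\<in>?S. \<Sum>c\<in>?S. \<Sum>b\<in>?S. \<pi> (R d c b a) v) = (\<Sum>d\<in>?S. \<Sum>a\<in>?S. \<Sum>c\<in>?S. \<Sum>b\<in>?S. \<pi> (R d c b a) v)"
      by (rule sum.swap)
    also have "\<dots> = (\<Sum>d\<in>?S. \<Sum>c\<in>?S. \<Sum>a\<in>?S. \<Sum>b\<in>?S. \<pi> (R d c b a) v)"
      by (intro sum.cong refl sum.swap)
    also have "\<dots> = (\<Sum>d\<in>?S. \<Sum>c\<in>?S. \<Sum>b\<in>?S. \<Sum>a\<in>?S. \<pi> (R d c b a) v)"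
      by (intro sum.cong refl sum.swap)
    finally show ?thesis .
  qed
  also have "\<dots> = T2 (T1 (T2 (T1 v)))"
    by (simp add: hecke_op_def \<pi>_sum \<pi>_mult R_def)
  finally show ?thesis .
qed

section \<open>Transport of the relations along \<open>theta\<close>\<close>

lemma theta_representation: "representation_with_form smul (\<lambda>g. \<pi> (theta g)) B q"
proof
  show "Sp4_representation smul (\<lambda>g. \<pi> (theta g))"
    unfolding Sp4_representation_def using linear_\<pi> vs.vector_space_axioms
    by (simp add: theta_mult \<pi>_mult)
  show "invariant_form smul (\<lambda>g. \<pi> (theta g)) B"
    unfolding invariant_form_def using B_linear B_invariant by simp
qed (rule q_def)

lemma theta_W: "representation_with_form.W (\<lambda>g. \<pi> (theta g)) = W"
proof -
  have "(\<forall>h\<in>iwahori. \<pi> (theta h) v = v) \<longleftrightarrow> (\<forall>h\<in>iwahori. \<pi> h v = v)" for v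
    by (metis theta_iwahori theta_theta)
  then show ?thesis
    unfolding representation_with_form.W_def[OF theta_representation] W_def fixed_vectors_def by simp
qed

lemma theta_T2: "hecke_op (\<lambda>g. \<pi> (theta g)) s2 x2 = T0"
  by (simp add: hecke_op_def fun_eq_iff theta_mult x0_def s0_def)

text \<open>Up to a sign matrix in the unit torus \<open>theta\<close> replaces \<open>t\<close> by
  \<open>- t\<close>, which permutes the residue classes.\<close>

lemma theta_T1:
  assumes v: "v \<in> W" shows "hecke_op (\<lambda>g. \<pi> (theta g)) s1 x1 v = T1 v"
proof -
  have z: "torus (-1) (-1) \<in> (iwahori :: ('f^4^4) set)"
    by (rule torus_iwahori) simp_all
  have "\<pi> (theta (x1 t ** s1)) v = \<pi> (x1 (0 - t) ** s1) v" for t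
  proof -
    have "theta (x1 t ** s1) = (x1 (0 - t) ** s1) ** torus (-1) (-1)"
      by (simp add: x1_def s1_def theta_mat4 torus_def)
    then show ?thesis
      using v z \<pi>_mult_fixed by simp
  qed
  then have "hecke_op (\<lambda>g. \<pi> (theta g)) s1 x1 v = (\<Sum>t\<in>residue_reps. \<pi> (x1 (0 - t) ** s1) v)"
    by (simp add: hecke_op_def)
  also have "\<dots> = T1 v"
    unfolding hecke_op_def
    by (rule sum_residue_reps_reflect[where F = "\<lambda>t. \<pi> (x1 t ** s1) v"])
      (use h1.T_summand_periodic[OF v] in auto)
  finally show ?thesis .
qed

lemma T1_T0_braid:
  assumes v: "v \<in> W" shows "T1 (T0 (T1 (T0 v))) = T0 (T1 (T0 (T1 v)))"
  using representation_with_form.T1_T2_braid[OF theta_representation] v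
  by (simp add: theta_W theta_T2 theta_T1)

text \<open>The vectors \<open>z1\<close> and \<open>z2\<close> are, up to scalars, the images of \<open>u\<close> under the symmetrizers of the
  dihedral Hecke algebra generated by \<open>X\<close> and \<open>Y\<close> for the characters with \<open>X = q\<close> and \<open>Y = q\<close> or \<open>Y = -1\<close>.\<close>

lemma dihedral_relation:
  fixes X Y :: "'w \<Rightarrow> 'w"
  assumes X: "\<And>v w. X (v + w) = X v + X w" "\<And>c v. X (smul c v) = smul c (X v)"
      "\<And>v. v \<in> W \<Longrightarrow> X v \<in> W" "\<And>v. v \<in> W \<Longrightarrow> X (X v) = smul (q - 1) (X v) + smul q v"
    and Y: "\<And>v w. Y (v + w) = Y v + Y w" "\<And>c v. Y (smul c v) = smul c (Y v)"
      "\<And>v. v \<in> W \<Longrightarrow> Y v \<in> W" "\<And>v. v \<in> W \<Longrightarrow> Y (Y v) = smul (q - 1) (Y v) + smul q v"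
    and braid: "\<And>v. v \<in> W \<Longrightarrow> X (Y (X (Y v))) = Y (X (Y (X v)))"
    and no_character: "\<And>v. v \<in> W \<Longrightarrow> X v = smul q v \<Longrightarrow> Y v = smul q v \<or> Y v = - v \<Longrightarrow> v = 0"
    and u: "u \<in> W" "X u = smul q u"
  shows "X (Y u) + Y u = smul (q - 1) u"
proof -
  define y p r where "y = Y u" and "p = X y" and "r = Y p"
  have W: "y \<in> W" "p \<in> W" "r \<in> W"
    using u X Y by (auto simp: y_def p_def r_def)
  have Xy: "X y = p" and Yu: "Y u = y" and Yp: "Y p = r"
    by (simp_all add: y_def p_def r_def)
  have Xp: "X p = smul (q - 1) p + smul q y" and Yy: "Y y = smul (q - 1) y + smul q u"
    and Yr: "Y r = smul (q - 1) r + smul q p"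
    using X(4)[OF W(1)] Y(4)[OF u(1)] Y(4)[OF W(2)] by (simp_all add: y_def p_def r_def)
  \<comment> \<open>The braid relation at \<open>u\<close>, whose right-hand side starts with
    \<open>X u = smul q u\<close>.\<close>
  have Xr: "X r = smul q r"
    using braid[OF u(1)] by (simp add: u(2) X(2) Y(2) y_def p_def r_def)
  define z1 where "z1 = u + y + p + r"
  have "X z1 = smul q z1" "Y z1 = smul q z1"
    by (simp_all add: z1_def X Y u(2) Xy Yu Yp Xp Yy Yr Xr algebra_simps)
  then have z1: "z1 = 0"
    using no_character[of z1] u W by (simp add: z1_def)
  define z2 where "z2 = smul (q * q) u - smul q y - smul q p + r"
  have minus: "X (v - w) = X v - X w" "Y (v - w) = Y v - Y w" for v w
    using X(1)[of "v - w" w] Y(1)[of "v - w" w] by simp_all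
  have "X z2 = smul q z2" "Y z2 = - z2"
    by (simp_all add: z2_def X Y minus u(2) Xy Yu Yp Xp Yy Yr Xr algebra_simps)
  then have z2: "z2 = 0"
    using no_character[of z2] u W by (simp add: z2_def)
  \<comment> \<open>The terms in \<open>r\<close> cancel, and \<open>1 + q\<close> factors out of
    the rest.\<close>
  have "smul (1 + q) (p + y - smul (q - 1) u) = z1 - z2"
    by (simp add: z1_def z2_def algebra_simps)
  then have "p + y - smul (q - 1) u = 0"
    by (simp add: z1 z2)
  then show ?thesis
    by (simp add: y_def p_def)
qed

end

text \<open>The two functionals differ by an invertible self-adjoint operator, which can be moved
  onto the representing vector; stability of \<open>D\<close> keeps that vector inside
  \<open>D\<close>.\<close>

lemma (in hecke_operator) W_functional_transfer:
  assumes D: "D \<subseteq> W" "\<And>d. d \<in> D \<Longrightarrow> T d \<in> D" "\<And>d e. d \<in> D \<Longrightarrow> e \<in> D \<Longrightarrow> d + e \<in> D"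
      "\<And>c d. d \<in> D \<Longrightarrow> smul c d \<in> D"
    and rel: "\<And>y. y \<in> W \<Longrightarrow> a (T y) = q * b y"
  shows "(\<exists>d\<in>D. \<forall>y\<in>W. a y = B d y) \<longleftrightarrow> (\<exists>d\<in>D. \<forall>y\<in>W. b y = B d y)"
proof
  assume "\<exists>d\<in>D. \<forall>y\<in>W. a y = B d y"
  then obtain d where d: "d \<in> D" "\<And>y. y \<in> W \<Longrightarrow> a y = B d y" by blast
  have "b y = B (smul (1 / q) (T d)) y" if "y \<in> W" for y
    using rel[OF that] d(2)[OF T_W[OF that]] B_T_selfadjoint[of d y] that d(1) D(1)
    by (auto simp: B_smul field_simps)
  then show "\<exists>d\<in>D. \<forall>y\<in>W. b y = B d y"
    using D(2,4) d(1) by (intro bexI[of _ "smul (1 / q) (T d)"] ballI) simp_all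
next
  assume "\<exists>d\<in>D. \<forall>y\<in>W. b y = B d y"
  then obtain d where d: "d \<in> D" "\<And>y. y \<in> W \<Longrightarrow> b y = B d y" by blast
  \<comment> \<open>By the quadratic relation \<open>S\<close> is \<open>q\<close> times the inverse
    of \<open>T\<close> on \<open>W\<close>.\<close>
  define S where "S y = T y + smul (- (q - 1)) y" for y
  have "a y = B (S d) y" if y: "y \<in> W" for y
  proof -
    have SW: "smul (1 / q) (S y) \<in> W"
      using y by (simp add: S_def)
    have "T (S y) = smul q y"
      by (simp add: S_def T_add T_smul T_diff T_quadratic[OF y] vs.scale_left_distrib[symmetric])
    then have "T (smul (1 / q) (S y)) = y"
      by (simp add: T_smul)
    then have "a y = q * B d (smul (1 / q) (S y))"
      using rel[OF SW] d(2)[OF SW] by simp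
    also have "\<dots> = B d (S y)"
      by (simp add: B_smul)
    also have "\<dots> = B (S d) y"
      using B_T_selfadjoint[of d y] y d(1) D(1) by (auto simp: S_def B_add B_smul)
    finally show ?thesis .
  qed
  moreover have "S d \<in> D"
    unfolding S_def using D(2-4) d(1) by simp
  ultimately show "\<exists>d\<in>D. \<forall>y\<in>W. a y = B d y"
    by blast
qed

section \<open>A nondegenerate skew form excludes Iwahori-fixed vectors\<close>

locale irreducible_skew = representation_with_form smul \<pi> B q
  for smul :: "complex \<Rightarrow> 'w::ab_group_add \<Rightarrow> 'w"
    and \<pi> :: "'f::nonarch_local_field_char_0^4^4 \<Rightarrow> 'w \<Rightarrow> 'w"
    and B :: "'w \<Rightarrow> 'w \<Rightarrow> complex" and q :: complex +
  assumes irreducible: "irreducible_rep smul \<pi>"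
    and nondegenerate: "nondegenerate_form B"
    and skew: "skew_symmetric_form B"
begin

lemma B_skew: "B v w = - B w v"
  using skew unfolding skew_symmetric_form_def by blast

lemma B_self [simp]: "B v v = 0"
  using B_skew[of v v] by simp

text \<open>The vectors whose whole orbit is orthogonal to \<open>v\<close> form an invariant
  subspace. It contains \<open>v\<close>, so it is everything, against nondegeneracy.\<close>

lemma matrix_coefficients_nonzero:
  assumes "v \<noteq> 0" "\<And>g. g \<in> Sp4 \<Longrightarrow> B (\<pi> g v) v = 0"
  shows False
proof -
  define U where "U = {x. \<forall>g\<in>Sp4. B (\<pi> g x) v = 0}"
  have "vs.subspace U"
    by (rule vs.subspaceI) (auto simp: U_def \<pi>_add \<pi>_smul B_add B_smul B_adjoint)
  moreover have "\<pi> g ` U \<subseteq> U" if "g \<in> Sp4" for g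
    using that by (auto simp: U_def \<pi>_mult[symmetric])
  moreover have "v \<in> U"
    using assms(2) by (simp add: U_def)
  ultimately have "U = UNIV"
    using irreducible assms(1) unfolding irreducible_rep_def by blast
  then have "B (\<pi> (mat 1) x) v = 0" for x
    unfolding U_def using Sp4_mat_1 by blast
  then have "v = 0"
    using nondegenerate unfolding nondegenerate_form_def by simp
  then show False
    using assms(1) by simp
qed

lemma matrix_coefficients_nonzero_monomial:
  assumes v: "v \<in> W" "v \<noteq> 0" and m: "\<And>w. w \<in> monomial_Sp4 \<Longrightarrow> B (\<pi> w v) v = 0"
  shows False
proof (rule matrix_coefficients_nonzero[OF v(2)])
  fix g :: "'f^4^4" assume "g \<in> Sp4"
  then obtain h w h' where h: "h \<in> iwahori" "w \<in> monomial_Sp4" "h' \<in> iwahori" "g = h ** w ** h'"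
    by (rule bruhat_decomposition)
  have "B (\<pi> (h ** w ** h') v) v = B (\<pi> (h ** w) v) v"
    using h v by (subst \<pi>_mult_fixed) auto
  also have "\<dots> = B (\<pi> w v) v"
    using h v by (intro B_iwahori_left) auto
  finally show "B (\<pi> g v) v = 0"
    using m h by simp
qed

text \<open>Nonzero eigenvalues let the vanishing of \<open>B (\<pi> w v) v\<close> pass both ways
  between \<open>w\<close> and \<open>s1 ** w\<close> or \<open>s2 ** w\<close>, so one
  \<open>w\<close> per coset of the finite Weyl group suffices.\<close>

lemma no_T1_T2_character:
  assumes v: "v \<in> W" and T1: "T1 v = smul a v" "a \<noteq> 0" and T2: "T2 v = smul b v" "b \<noteq> 0"
  shows "v = 0"
proof (rule ccontr)
  assume "v \<noteq> 0"
  have st1: "B (\<pi> (s1 ** w) v) v = 0 \<longleftrightarrow> B (\<pi> w v) v = 0" if "w \<in> monomial_Sp4" for w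
  proof (cases rule: h1.B_T_dichotomy[OF that])
    case 1
    from 1[OF v v] show ?thesis using T1 by (auto simp: B_smul)
  next
    case 2
    from 2[OF v v] show ?thesis using T1 by (auto simp: B_smul)
  qed
  have st2: "B (\<pi> (s2 ** w) v) v = 0 \<longleftrightarrow> B (\<pi> w v) v = 0" if "w \<in> monomial_Sp4" for w
  proof (cases rule: h2.B_T_dichotomy[OF that])
    case 1
    from 1[OF v v] show ?thesis using T2 by (auto simp: B_smul)
  next
    case 2
    from 2[OF v v] show ?thesis using T2 by (auto simp: B_smul)
  qed
  show False
  proof (rule matrix_coefficients_nonzero_monomial[OF v \<open>v \<noteq> 0\<close>])
    fix w :: "'f^4^4" assume "w \<in> monomial_Sp4"
    then show "B (\<pi> w v) v = 0"
    proof (induction rule: monomial_induct_finite)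
      case (torus c d)
      then have t: "torus c d \<in> monomial_Sp4"
        by (rule torus_monomial)
      \<comment> \<open>The longest element inverts the torus, so \<open>w\<close> squares to
        \<open>torus (-1) (-1)\<close>, which fixes \<open>v\<close>: this is the involution in the
        coset.\<close>
      define w where "w = s1 ** (s2 ** (s1 ** (s2 ** torus c d)))"
      have w: "w \<in> Sp4"
        using t by (simp add: w_def)
      have "w ** w = torus (-1) (-1)"
        using torus by (simp add: w_def torus_def s1_def s2_def)
      then have ww: "spinv (w ** w) \<in> iwahori"
        by (simp add: torus_iwahori)
      have "spinv w = w ** spinv (w ** w)"
        using w by (simp add: mat_simps)
      then have "\<pi> (spinv w) v = \<pi> w v"
        using \<pi>_mult_fixed[OF w ww v] by simp
      then have "B (\<pi> w v) v = B v (\<pi> w v)"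
        using w by (simp add: B_adjoint)
      then have "B (\<pi> w v) v = 0"
        using B_skew[of v "\<pi> w v"] by simp
      then show ?case
        using t by (simp add: w_def st1 st2)
    qed (simp_all add: st1 st2)
  qed
qed

lemma theta_irreducible_skew: "irreducible_skew smul (\<lambda>g. \<pi> (theta g)) B q"
proof (intro irreducible_skew.intro irreducible_skew_axioms.intro theta_representation nondegenerate skew)
  have "(\<forall>g\<in>Sp4. \<pi> (theta g) ` U \<subseteq> U) \<longleftrightarrow> (\<forall>g\<in>Sp4. \<pi> g ` U \<subseteq> U)" for U
    by (metis theta_Sp4 theta_theta)
  then show "irreducible_rep smul (\<lambda>g. \<pi> (theta g))"
    using irreducible unfolding irreducible_rep_def by simp
qed

lemma no_T1_T0_character:
  assumes "v \<in> W" "T1 v = smul a v" "a \<noteq> 0" "T0 v = smul b v" "b \<noteq> 0"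
  shows "v = 0"
  by (rule irreducible_skew.no_T1_T2_character[OF theta_irreducible_skew, unfolded theta_W theta_T2,
        where a = a and b = b])
    (use assms theta_T1 in simp_all)

lemma eigenvector_q_or_minus_one:
  assumes "Y v = smul q v \<or> Y v = - v"
  obtains b where "Y v = smul b v" "b \<noteq> 0"
  using assms that[of q] that[of "-1"] by auto

text \<open>Written as (T1+1)(T2+1) u = 2q u, this is the Temperley-Lieb relation of the reflection
  representation.\<close>

lemma T1_T2_relation:
  assumes "u \<in> W" "T1 u = smul q u" shows "T1 (T2 u) + T2 u = smul (q - 1) u"
proof (rule dihedral_relation)
  show "v = 0" if v: "v \<in> W" "T1 v = smul q v" "T2 v = smul q v \<or> T2 v = - v" for v
  proof -
    obtain b where "T2 v = smul b v" "b \<noteq> 0"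
      using v(3) by (rule eigenvector_q_or_minus_one)
    then show ?thesis
      by (rule no_T1_T2_character[OF v(1,2) q_nonzero])
  qed
qed (use assms in \<open>simp_all add: h1.T_add h1.T_smul h2.T_add h2.T_smul h1.T_quadratic h2.T_quadratic T1_T2_braid\<close>)

lemma T1_T0_relation:
  assumes "u \<in> W" "T1 u = smul q u" shows "T1 (T0 u) + T0 u = smul (q - 1) u"
proof (rule dihedral_relation)
  show "v = 0" if v: "v \<in> W" "T1 v = smul q v" "T0 v = smul q v \<or> T0 v = - v" for v
  proof -
    obtain b where "T0 v = smul b v" "b \<noteq> 0"
      using v(3) by (rule eigenvector_q_or_minus_one)
    then show ?thesis
      by (rule no_T1_T0_character[OF v(1,2) q_nonzero])
  qed
qed (use assms in \<open>simp_all add: h1.T_add h1.T_smul h0.T_add h0.T_smul h1.T_quadratic h0.T_quadratic T1_T0_braid\<close>)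

text \<open>By the quadratic relation \<open>T1 + 1\<close> maps \<open>W\<close> into the
  q-eigenspace. If it vanished, \<open>T1\<close> would act by -1 and every eigenvector of
  \<open>T2\<close> would be a common one; either \<open>T2 v + v\<close> or \<open>v\<close> itself
  is a nonzero such vector.\<close>

lemma ex_T1_eigenvector:
  assumes "v \<in> W" "v \<noteq> 0"
  obtains u where "u \<in> W" "u \<noteq> 0" "T1 u = smul q u"
proof -
  have eig: "T1 (T1 u + u) = smul q (T1 u + u)" if "u \<in> W" for u
    using h1.T_quadratic[OF that] by (simp add: h1.T_add algebra_simps)
  have "\<exists>u\<in>W. T1 u + u \<noteq> 0"
  proof (rule ccontr)
    assume "\<not> ?thesis"
    then have minus: "T1 u = smul (-1) u" if "u \<in> W" for u
      using that by (simp add: eq_neg_iff_add_eq_0)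
    have "T2 (T2 v + v) = smul q (T2 v + v)"
      using h2.T_quadratic[OF assms(1)] by (simp add: h2.T_add algebra_simps)
    then have "T2 v + v = 0"
      using assms(1) by (intro no_T1_T2_character[OF _ minus _ _ q_nonzero]) simp_all
    then have "T2 v = smul (-1) v"
      by (simp add: eq_neg_iff_add_eq_0)
    then have "v = 0"
      by (rule no_T1_T2_character[OF assms(1) minus[OF assms(1)], rotated]) simp_all
    then show False
      using assms(2) by simp
  qed
  then show thesis
    using that eig by blast
qed

text \<open>The subspace \<open>D\<close> below contains \<open>v\<close>, is stable under \<open>T0\<close>, \<open>T1\<close>, \<open>T2\<close>, and is orthogonal to \<open>v\<close>.
  As the Hecke operators are invertible on \<open>W\<close>, every functional \<open>B (\<pi> w v)\<close> agrees on \<open>W\<close> with \<open>B d\<close>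
  for some \<open>d\<close> in \<open>D\<close>; this avoids projecting \<open>\<pi> w v\<close> to \<open>W\<close>.\<close>

lemma W_trivial:
  assumes "v \<in> W" shows "v = 0"
proof (rule ccontr)
  assume "v \<noteq> 0"
  then obtain v where v: "v \<in> W" "v \<noteq> 0" "T1 v = smul q v"
    using ex_T1_eigenvector assms by blast
  \<comment> \<open>On \<open>W\<close>, \<open>T1 + 1\<close> is \<open>1 + q\<close> times the
    projection onto the q-eigenspace \<open>V\<close>; up to this factor \<open>X\<close> is the
    compression of \<open>T0 T2\<close> to \<open>V\<close>.\<close>
  define X where "X p = T1 (T0 (T2 p)) + T0 (T2 p)" for p
  define V where "V = {p \<in> W. T1 p = smul q p}"
  have X_add: "X (p + p') = X p + X p'" and X_smul: "X (smul c p) = smul c (X p)" for p p' c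
    by (simp_all add: X_def h0.T_add h1.T_add h2.T_add h0.T_smul h1.T_smul h2.T_smul algebra_simps)
  have X_pow_add: "(X ^^ k) (p + p') = (X ^^ k) p + (X ^^ k) p'"
    and X_pow_smul: "(X ^^ k) (smul c p) = smul c ((X ^^ k) p)" for k p p' c
    by (induction k) (simp_all add: X_add X_smul)
  have VW: "p \<in> W" and T1_V: "T1 p = smul q p" if "p \<in> V" for p
    using that by (simp_all add: V_def)
  have X_V: "X p \<in> V" if "p \<in> V" for p
    using h1.T_quadratic[of "T0 (T2 p)"] VW[OF that]
    by (simp add: V_def X_def h1.T_add algebra_simps)
  have X_pow_V: "(X ^^ k) p \<in> V" if "p \<in> V" for p k
    by (induction k) (simp_all add: that X_V)
  \<comment> \<open>The projection onto \<open>V\<close> is self-adjoint and fixes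
    \<open>p\<close>.\<close>
  have absorb: "(1 + q) * B x p = B (T1 x + x) p" if "x \<in> W" "p \<in> V" for x p
    using h1.B_T_selfadjoint[of x p] that VW T1_V by (simp add: B_add B_smul algebra_simps)
  have X_selfadjoint: "B (X p) p' = B p (X p')" if "p \<in> V" "p' \<in> V" for p p'
  proof -
    have "B (X p) p' = (1 + q) * B (T0 (T2 p)) p'"
      using absorb[of "T0 (T2 p)" p'] that VW by (simp add: X_def)
    also have "B (T0 (T2 p)) p' = B p (T0 (T2 p'))"
      using h0.B_T_selfadjoint[of "T2 p" p'] h2.B_T_selfadjoint[of p "T0 p'"] that VW
      by (simp add: T0_T2_commute)
    also have "(1 + q) * B p (T0 (T2 p')) = B p (X p')"
      using absorb[of "T0 (T2 p')" p] B_skew[of p] that VW by (simp add: X_def)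
    finally show ?thesis .
  qed
  have X_pow_selfadjoint: "B ((X ^^ k) p) p' = B p ((X ^^ k) p')" if "p \<in> V" "p' \<in> V" for k p p'
    using that(2)
  proof (induction k arbitrary: p')
    case (Suc k)
    then show ?case
      using X_selfadjoint[OF X_pow_V[OF that(1)]] X_V by (simp add: funpow_swap1)
  qed simp
  \<comment> \<open>The largest \<open>X\<close>-stable subspace of \<open>V\<close> that is
    orthogonal to \<open>v\<close>.\<close>
  define P where "P = {p \<in> V. \<forall>k. B ((X ^^ k) p) v = 0}"
  have PV: "p \<in> V" and PW: "p \<in> W" and P_B: "B p v = 0" "B (X p) v = 0" if "p \<in> P" for p
  proof -
    have "B ((X ^^ 0) p) v = 0" "B ((X ^^ 1) p) v = 0"
      using that unfolding P_def by blast+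
    then show "B p v = 0" "B (X p) v = 0" by simp_all
  qed (use that VW in \<open>auto simp: P_def\<close>)
  have vV: "v \<in> V"
    using v by (simp add: V_def)
  have "B ((X ^^ k) v) v = 0" for k
    using X_pow_selfadjoint[OF vV vV, of k] B_skew[of v "(X ^^ k) v"] by simp
  then have vP: "v \<in> P"
    using vV by (simp add: P_def)
  have P_add: "p + p' \<in> P" if "p \<in> P" "p' \<in> P" for p p'
    using that by (simp add: P_def V_def X_pow_add B_add h1.T_add algebra_simps)
  have P_smul: "smul c p \<in> P" if "p \<in> P" for c p
    using that by (simp add: P_def V_def X_pow_smul B_smul h1.T_smul mult.commute)
  have P_minus: "- p \<in> P" if "p \<in> P" for p
    using P_smul[OF that, of "-1"] by simp
  have P_zero: "0 \<in> P"
    using P_smul[OF vP, of 0] by simp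
  have P_X: "X p \<in> P" if "p \<in> P" for p
  proof -
    have "B ((X ^^ k) (X p)) v = 0" for k
    proof -
      have "B ((X ^^ Suc k) p) v = 0"
        using that unfolding P_def by blast
      then show ?thesis by (simp add: funpow_swap1)
    qed
    then show ?thesis
      using X_V[of p] that by (simp add: P_def)
  qed
  \<comment> \<open>The four coefficients 1, T2, T0, T0 T2 span the algebra generated by the
    commuting T0 and T2. \<open>T1\<close> leads back to such combinations by its relations with T2
    and T0 and, on the last term, by the definition of \<open>X\<close>.\<close>
  define comb where "comb p1 p2 p3 p4 = p1 + T2 p2 + T0 p3 + T0 (T2 p4)" for p1 p2 p3 p4
  define D where "D = {comb p1 p2 p3 p4 | p1 p2 p3 p4. p1 \<in> P \<and> p2 \<in> P \<and> p3 \<in> P \<and> p4 \<in> P}"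
  have DI: "comb p1 p2 p3 p4 \<in> D" if "p1 \<in> P" "p2 \<in> P" "p3 \<in> P" "p4 \<in> P" for p1 p2 p3 p4
    using that by (auto simp: D_def)
  note T_lin = h0.T_add h1.T_add h2.T_add h0.T_diff h1.T_diff h2.T_diff h0.T_smul h1.T_smul h2.T_smul
  have T_zero: "T0 0 = 0" "T2 0 = 0"
    using h0.T_smul[of 0 0] h2.T_smul[of 0 0] by simp_all
  have T_minus: "T0 (- x) = - T0 x" "T2 (- x) = - T2 x" for x
    using h0.T_smul[of "-1" x] h2.T_smul[of "-1" x] by simp_all
  have D_W: "D \<subseteq> W"
    by (auto simp: D_def comb_def PW)
  have D_add: "d + e \<in> D" if d: "d \<in> D" and e: "e \<in> D" for d e
  proof -
    obtain p1 p2 p3 p4 where p: "p1 \<in> P" "p2 \<in> P" "p3 \<in> P" "p4 \<in> P" "d = comb p1 p2 p3 p4"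
      using d unfolding D_def by blast
    obtain r1 r2 r3 r4 where r: "r1 \<in> P" "r2 \<in> P" "r3 \<in> P" "r4 \<in> P" "e = comb r1 r2 r3 r4"
      using e unfolding D_def by blast
    have eq: "d + e = comb (p1 + r1) (p2 + r2) (p3 + r3) (p4 + r4)"
      by (simp add: p(5) r(5) comb_def T_lin algebra_simps)
    show "d + e \<in> D"
      unfolding eq by (intro DI P_add p(1-4) r(1-4))
  qed
  have D_smul: "smul c d \<in> D" if d: "d \<in> D" for c d
  proof -
    obtain p1 p2 p3 p4 where P: "p1 \<in> P" "p2 \<in> P" "p3 \<in> P" "p4 \<in> P" and d: "d = comb p1 p2 p3 p4"
      using d unfolding D_def by blast
    have eq: "smul c d = comb (smul c p1) (smul c p2) (smul c p3) (smul c p4)"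
      by (simp add: d comb_def T_lin algebra_simps)
    show "smul c d \<in> D"
      unfolding eq by (intro DI P_add P_smul P_minus P_X P)
  qed
  have D_T2: "T2 d \<in> D" if d: "d \<in> D" for d
  proof -
    obtain p1 p2 p3 p4 where P: "p1 \<in> P" "p2 \<in> P" "p3 \<in> P" "p4 \<in> P" and d: "d = comb p1 p2 p3 p4"
      using d unfolding D_def by blast
    have eq: "T2 d = comb (smul q p2) (p1 + smul (q - 1) p2) (smul q p4) (p3 + smul (q - 1) p4)"
      by (simp add: d comb_def T_lin T0_T2_commute[symmetric] h2.T_quadratic PW P algebra_simps)
    show "T2 d \<in> D"
      unfolding eq by (intro DI P_add P_smul P_minus P_X P)
  qed
  have D_T0: "T0 d \<in> D" if d: "d \<in> D" for d
  proof -
    obtain p1 p2 p3 p4 where P: "p1 \<in> P" "p2 \<in> P" "p3 \<in> P" "p4 \<in> P" and d: "d = comb p1 p2 p3 p4"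
      using d unfolding D_def by blast
    have eq: "T0 d = comb (smul q p3) (smul q p4) (p1 + smul (q - 1) p3) (p2 + smul (q - 1) p4)"
      by (simp add: d comb_def T_lin h0.T_quadratic PW P algebra_simps)
    show "T0 d \<in> D"
      unfolding eq by (intro DI P_add P_smul P_minus P_X P)
  qed
  have D_T1: "T1 d \<in> D" if d: "d \<in> D" for d
  proof -
    obtain p1 p2 p3 p4 where P: "p1 \<in> P" "p2 \<in> P" "p3 \<in> P" "p4 \<in> P" and d: "d = comb p1 p2 p3 p4"
      using d unfolding D_def by blast
    have T1_T: "T1 (T2 p2) = smul (q - 1) p2 - T2 p2" "T1 (T0 p3) = smul (q - 1) p3 - T0 p3"
      using T1_T2_relation[of p2] T1_T0_relation[of p3] P PV VW T1_V
      by (simp_all add: eq_diff_eq)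
    have T1_TT: "T1 (T0 (T2 p4)) = X p4 - T0 (T2 p4)"
      by (simp add: X_def)
    have eq: "T1 d = comb (smul q p1 + smul (q - 1) p2 + smul (q - 1) p3 + X p4) (- p2) (- p3) (- p4)"
      by (simp add: d comb_def T_lin T_minus T1_T T1_TT P PV T1_V algebra_simps)
    show "T1 d \<in> D"
      unfolding eq by (intro DI P_add P_smul P_minus P_X P)
  qed
  have "comb v 0 0 0 = v"
    by (simp add: comb_def T_zero)
  then have vD: "v \<in> D"
    using DI[of v 0 0 0] vP P_zero by simp
  have D_B: "B d v = 0" if d: "d \<in> D" for d
  proof -
    obtain p1 p2 p3 p4 where P: "p1 \<in> P" "p2 \<in> P" "p3 \<in> P" "p4 \<in> P" and d: "d = comb p1 p2 p3 p4"
      using d unfolding D_def by blast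
    \<comment> \<open>Applying \<open>T1 + 1\<close> turns the three vectors into multiples of
      \<open>p2\<close> and \<open>p3\<close> and into \<open>X p4\<close>, all orthogonal to
      \<open>v\<close>.\<close>
    have "(1 + q) * B (T2 p2) v = 0" "(1 + q) * B (T0 p3) v = 0" "(1 + q) * B (T0 (T2 p4)) v = 0"
      using absorb[OF _ vV, of "T2 p2"] absorb[OF _ vV, of "T0 p3"] absorb[OF _ vV, of "T0 (T2 p4)"]
        T1_T2_relation[of p2] T1_T0_relation[of p3] P PV VW T1_V P_B
      by (simp_all add: B_smul X_def)
    then show "B d v = 0"
      using P P_B(1) by (simp add: d comb_def B_add)
  qed
  have represented: "\<exists>d\<in>D. \<forall>y\<in>W. B (\<pi> w v) y = B d y" if "w \<in> monomial_Sp4" for w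
    using that
  proof (induction rule: monomial_induct_affine)
    case (s0 w)
    show ?case
    proof (cases rule: h0.B_T_dichotomy[OF s0])
      case 1
      show ?thesis
        by (rule h0.W_functional_transfer[where a = "B (\<pi> w v)" and b = "B (\<pi> (s0 ** w) v)", symmetric])
          (assumption | rule D_W D_T0 D_add D_smul 1[OF v(1)])+
    next
      case 2
      show ?thesis
        by (rule h0.W_functional_transfer[where a = "B (\<pi> (s0 ** w) v)" and b = "B (\<pi> w v)"])
          (assumption | rule D_W D_T0 D_add D_smul 2[OF v(1)])+
    qed
  next
    case (s1 w)
    show ?case
    proof (cases rule: h1.B_T_dichotomy[OF s1])
      case 1
      show ?thesis
        by (rule h1.W_functional_transfer[where a = "B (\<pi> w v)" and b = "B (\<pi> (s1 ** w) v)", symmetric])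
          (assumption | rule D_W D_T1 D_add D_smul 1[OF v(1)])+
    next
      case 2
      show ?thesis
        by (rule h1.W_functional_transfer[where a = "B (\<pi> (s1 ** w) v)" and b = "B (\<pi> w v)"])
          (assumption | rule D_W D_T1 D_add D_smul 2[OF v(1)])+
    qed
  next
    case (s2 w)
    show ?case
    proof (cases rule: h2.B_T_dichotomy[OF s2])
      case 1
      show ?thesis
        by (rule h2.W_functional_transfer[where a = "B (\<pi> w v)" and b = "B (\<pi> (s2 ** w) v)", symmetric])
          (assumption | rule D_W D_T2 D_add D_smul 1[OF v(1)])+
    next
      case 2
      show ?thesis
        by (rule h2.W_functional_transfer[where a = "B (\<pi> (s2 ** w) v)" and b = "B (\<pi> w v)"])
          (assumption | rule D_W D_T2 D_add D_smul 2[OF v(1)])+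
    qed
  next
    case (torus a b)
    then have "\<pi> (torus a b) v = v"
      using v(1) torus_iwahori W_fixed by blast
    then show ?case
      using vD by auto
  qed
  show False
  proof (rule matrix_coefficients_nonzero_monomial[OF v(1,2)])
    fix w :: "'f^4^4" assume "w \<in> monomial_Sp4"
    then obtain d where "d \<in> D" "\<forall>y\<in>W. B (\<pi> w v) y = B d y"
      using represented by blast
    then show "B (\<pi> w v) v = 0"
      using D_B v(1) by simp
  qed
qed

end

subsection \<open>The sign\<close>

text \<open>If \<open>I\<close> is the conjugate by \<open>g\<close>, then
  \<open>\<pi> (spinv g)\<close> carries its fixed vectors to those of the standard
  subgroup.\<close>

lemma iwahori_subgroup_fixed_vectors:
  assumes rep: "Sp4_representation smul \<pi>" and I: "iwahori_subgroup I" and v: "fixed_vectors \<pi> I \<noteq> {0}"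
  obtains v where "v \<in> fixed_vectors \<pi> standard_iwahori" "v \<noteq> 0"
proof -
  have lin: "\<pi> h 0 = 0" if "h \<in> Sp4" for h
    using rep that module_hom.zero[OF Vector_Spaces.linear.axioms(3)]
    unfolding Sp4_representation_def by blast
  obtain g where g: "g \<in> Sp4" "I = (\<lambda>h. g ** h ** spinv g) ` iwahori"
    using I unfolding iwahori_subgroup_def by (auto simp: matrix_inv_Sp4)
  have mult: "\<pi> (h ** k) w = \<pi> h (\<pi> k w)" if "h \<in> Sp4" "k \<in> Sp4" for h k w
    using rep that unfolding Sp4_representation_def by blast
  have one: "\<pi> (mat 1) w = w" for w
    using rep unfolding Sp4_representation_def by blast
  have "0 \<in> fixed_vectors \<pi> I"
    using g lin by (auto simp: fixed_vectors_def)
  then obtain u where u: "u \<in> fixed_vectors \<pi> I" "u \<noteq> 0"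
    using v by blast
  show thesis
  proof (rule that[of "\<pi> (spinv g) u"])
    have "\<pi> h (\<pi> (spinv g) u) = \<pi> (spinv g) u" if "h \<in> iwahori" for h
    proof -
      have h: "h \<in> Sp4" using that by simp
      have "\<pi> (g ** h ** spinv g) u = u"
        using u(1) that g(2) by (auto simp: fixed_vectors_def)
      then have "\<pi> (spinv g) u = \<pi> (spinv g ** (g ** h ** spinv g)) u"
        using g(1) h by (simp add: mult)
      also have "spinv g ** (g ** h ** spinv g) = h ** spinv g"
        using g(1) by (simp add: mat_simps)
      finally show ?thesis
        using g(1) h by (simp add: mult)
    qed
    then show "\<pi> (spinv g) u \<in> fixed_vectors \<pi> iwahori"
      by (simp add: fixed_vectors_def)
    show "\<pi> (spinv g) u \<noteq> 0"
    proof
      assume "\<pi> (spinv g) u = 0"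
      then have "\<pi> (g ** spinv g) u = 0"
        using g(1) lin mult[of g "spinv g" u] by (simp del: Sp4_cancel)
      then show False
        using g(1) u(2) one by simp
    qed
  qed
qed

text \<open>The isomorphism with the smooth dual, read as a form in two arguments. Injectivity makes
  the left radical trivial; the right radical is an invariant subspace, and were it everything, so
  would be the left one.\<close>

lemma self_dual_invariant_form:
  fixes smul :: "complex \<Rightarrow> 'w::ab_group_add \<Rightarrow> 'w"
  assumes rep: "Sp4_representation smul \<pi>" and irr: "irreducible_rep smul \<pi>" and sd: "self_dual smul \<pi>"
  obtains B where "invariant_form smul \<pi> B" "nondegenerate_form B"
proof -
  obtain \<phi> where bij: "bij_betw \<phi> UNIV (smooth_dual smul \<pi>)"
    and add: "\<And>v w. \<phi> (v + w) = (\<lambda>x. \<phi> v x + \<phi> w x)"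
    and scale: "\<And>c v. \<phi> (smul c v) = (\<lambda>x. c * \<phi> v x)"
    and eqv: "\<And>g v. g \<in> Sp4 \<Longrightarrow> \<phi> (\<pi> g v) = dual_action \<pi> g (\<phi> v)"
    using sd unfolding self_dual_def by blast
  have lin: "Vector_Spaces.linear smul (*) (\<phi> v)" for v
    using bij unfolding bij_betw_def smooth_dual_def by blast
  have vs: "vector_space smul"
    using rep by (simp add: Sp4_representation_def)
  interpret vs: vector_space smul by (rule vs)
  have vs': "vector_space ((*) :: complex \<Rightarrow> complex \<Rightarrow> complex)"
    by unfold_locales (simp_all add: algebra_simps)
  have lin': "Vector_Spaces.linear smul (*) (\<lambda>v. \<phi> v w)" for w
    unfolding Vector_Spaces.linear_iff using vs vs' by (simp add: add scale)
  have lin\<pi>: "Vector_Spaces.linear smul smul (\<pi> g)" if "g \<in> Sp4" for g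
    using rep that by (simp add: Sp4_representation_def)
  have inv: "\<phi> (\<pi> g v) (\<pi> g w) = \<phi> v w" if "g \<in> Sp4" for g v w
  proof -
    have "\<pi> (spinv g ** g) w = \<pi> (spinv g) (\<pi> g w)"
      using rep that unfolding Sp4_representation_def by blast
    moreover have "\<pi> (mat 1) w = w"
      using rep unfolding Sp4_representation_def by blast
    ultimately show ?thesis
      using that by (simp add: eqv dual_action_def matrix_inv_Sp4)
  qed
  have "invariant_form smul \<pi> \<phi>"
    unfolding invariant_form_def using lin lin' inv by blast
  have inj: "v = 0" if "\<forall>w. \<phi> v w = 0" for v
  proof -
    have "\<phi> 0 = (\<lambda>x. 0)"
      using scale[of 0 0] by simp
    then have "\<phi> v = \<phi> 0"
      using that by auto
    then show ?thesis
      using bij by (simp add: bij_betw_def inj_eq)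
  qed
  have "w = 0" if w: "\<forall>v. \<phi> v w = 0" for w
  proof (rule ccontr)
    assume "w \<noteq> 0"
    define U where "U = {w. \<forall>v. \<phi> v w = 0}"
    have "vs.subspace U"
      using lin unfolding Vector_Spaces.linear_iff
      by (intro vs.subspaceI) (auto simp: U_def module_hom.zero[OF Vector_Spaces.linear.axioms(3)[OF lin]])
    moreover have "\<pi> g ` U \<subseteq> U" if g: "g \<in> Sp4" for g
    proof -
      have "\<phi> v (\<pi> g w) = 0" if "w \<in> U" for v w
      proof -
        have "\<pi> (g ** spinv g) v = \<pi> g (\<pi> (spinv g) v)" "\<pi> (mat 1) v = v"
          using rep g spinv_Sp4 unfolding Sp4_representation_def by blast+
        then have "\<phi> v (\<pi> g w) = \<phi> (\<pi> g (\<pi> (spinv g) v)) (\<pi> g w)"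
          using g by simp
        then show ?thesis
          using inv[OF g] that by (simp add: U_def)
      qed
      then show ?thesis by (auto simp: U_def)
    qed
    ultimately have "U = UNIV"
      using irr w \<open>w \<noteq> 0\<close> unfolding irreducible_rep_def U_def by blast
    then have "v = 0" for v :: 'w
      using inj[of v] unfolding U_def by blast
    then show False
      using \<open>w \<noteq> 0\<close> by blast
  qed
  then have "nondegenerate_form \<phi>"
    unfolding nondegenerate_form_def using inj by blast
  with \<open>invariant_form smul \<pi> \<phi>\<close> show thesis
    by (rule that)
qed

lemma invariant_form_symmetric:
  assumes rep: "Sp4_representation smul \<pi>" and irr: "irreducible_rep smul \<pi>"
    and v: "v \<in> fixed_vectors \<pi> standard_iwahori" "v \<noteq> 0"
    and B: "invariant_form smul (\<pi> :: 'f::nonarch_local_field_char_0^4^4 \<Rightarrow> 'w::ab_group_add \<Rightarrow> 'w) B"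
  shows "symmetric_form B"
proof -
  define q where "q = complex_of_nat (card (residue_reps :: 'f set))"
  interpret B: representation_with_form smul \<pi> B q
    using rep B by unfold_locales (simp_all add: q_def)
  define A where "A v w = B v w - B w v" for v w
  have vs': "vector_space ((*) :: complex \<Rightarrow> complex \<Rightarrow> complex)"
    by unfold_locales (simp_all add: algebra_simps)
  have lin: "Vector_Spaces.linear smul (*) (\<lambda>w. A v w)" "Vector_Spaces.linear smul (*) (\<lambda>v. A v w)" for v w
    unfolding Vector_Spaces.linear_iff A_def using B.vs.vector_space_axioms vs'
    by (simp_all add: B.B_add B.B_smul algebra_simps)
  have "A (\<pi> g v) (\<pi> g w) = A v w" if "g \<in> Sp4" for g v w
    using that by (simp add: A_def B.B_invariant)
  then have A: "invariant_form smul \<pi> A"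
    unfolding invariant_form_def using lin by blast
  interpret A: representation_with_form smul \<pi> A q
    using rep A by unfold_locales (simp_all add: q_def)
  define U where "U = {v. \<forall>w. A v w = 0}"
  have "B.vs.subspace U"
    by (rule B.vs.subspaceI) (auto simp: U_def A.B_add A.B_smul)
  moreover have "\<pi> g ` U \<subseteq> U" if "g \<in> Sp4" for g
    using that by (auto simp: U_def A.B_adjoint)
  ultimately have "U = {0} \<or> U = UNIV"
    using irr unfolding irreducible_rep_def by blast
  moreover have "U \<noteq> {0}"
  proof
    assume U: "U = {0}"
    have skew: "A v w = - A w v" for v w
      by (simp add: A_def)
    have "v = 0" if "\<forall>w. A v w = 0" for v
      using that U unfolding U_def by blast
    moreover from this have "w = 0" if "\<forall>v. A v w = 0" for w
      using that skew by (metis neg_equal_0_iff_equal)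
    ultimately have "nondegenerate_form A"
      unfolding nondegenerate_form_def by blast
    moreover have "skew_symmetric_form A"
      unfolding skew_symmetric_form_def using skew by blast
    ultimately interpret irreducible_skew smul \<pi> A q
      using irr A.representation_with_form_axioms
      by (intro irreducible_skew.intro irreducible_skew_axioms.intro)
    show False
      using W_trivial v unfolding B.W_def by blast
  qed
  ultimately have "A v w = 0" for v w
    unfolding U_def by blast
  then show ?thesis
    by (simp add: symmetric_form_def A_def)
qed

theorem theorem1p1:
  fixes smul :: "complex \<Rightarrow> 'w::ab_group_add \<Rightarrow> 'w"
    and \<pi> :: "'f::nonarch_local_field_char_0^4^4 \<Rightarrow> 'w \<Rightarrow> 'w"
    and I :: "('f^4^4) set"
  assumes "Sp4_representation smul \<pi>"
    and "smooth_rep \<pi>"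
    and "irreducible_rep smul \<pi>"
    and "self_dual smul \<pi>"
    and "iwahori_subgroup I"
    and "fixed_vectors \<pi> I \<noteq> {0}"
  shows "rep_sign smul \<pi> = 1 \<and>
         (\<exists>B. invariant_form smul \<pi> B \<and> nondegenerate_form B) \<and>
         (\<forall>B. invariant_form smul \<pi> B \<and> nondegenerate_form B \<longrightarrow> symmetric_form B)"
proof -
  obtain v where v: "v \<in> fixed_vectors \<pi> standard_iwahori" "v \<noteq> 0"
    using iwahori_subgroup_fixed_vectors[OF assms(1,5,6)] .
  have symmetric: "symmetric_form B" if "invariant_form smul \<pi> B" for B
    using invariant_form_symmetric[OF assms(1,3) v that] .
  obtain B where B: "invariant_form smul \<pi> B" "nondegenerate_form B"
    using self_dual_invariant_form[OF assms(1,3,4)] .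
  \<comment> \<open>Excludes the value -1 in the definite description of the sign: a form that is
    both symmetric and skew vanishes.\<close>
  have "\<not> skew_symmetric_form C" if "invariant_form smul \<pi> C" "nondegenerate_form C" for C
  proof
    assume "skew_symmetric_form C"
    then have "C v w = - C w v" "C v w = C w v" for w
      using symmetric[OF that(1)] unfolding symmetric_form_def skew_symmetric_form_def by blast+
    then have "2 * C v w = 0" for w
      by (metis add.left_inverse mult_2)
    then have "C v w = 0" for w
      by simp
    then show False
      using that(2) v(2) unfolding nondegenerate_form_def by blast
  qed
  then have "rep_sign smul \<pi> = 1"
    unfolding rep_sign_def using B symmetric by (intro the_equality) auto
  then show ?thesis
    using B symmetric by blast
qed

end
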